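(* Let $n\geqslant 10$ and $n+1\leqslant r\leqslant 2n-9$, and let $\rho: B_n\to GL_r(\mathbb{C})$ be an irreducible matrix representation of $B_n$ of dimension $r$. Then $\rho$ is equivalent to a tensor product of a one-dimensional representation of $B_n$ and an irreducible representation $\widehat{\rho}$ of $B_n$ of dimension $r$ and corank $k$, where $3\leqslant k\leqslant r-n+2$.
   Context: $B_n$ is the braid group on $n$ strings, presented by the standard generators $\sigma_1,\dots,\sigma_{n-1}$ with relations $\sigma_i\sigma_j=\sigma_j\sigma_i$ for $|i-j|\geqslant 2$ and $\sigma_i\sigma_{i+1}\sigma_i=\sigma_{i+1}\sigma_i\sigma_{i+1}$ for $1\leqslant i\leqslant n-2$. The corank of a representation $\rho: B_n\to GL_r(\mathbb{C})$ is $\mathrm{corank}(\rho)=\mathrm{rank}(\rho(\sigma_1)-I)$ (which equals $\mathrm{rank}(\rho(\sigma_i)-I)$ for every $i$, since the $\sigma_i$ are conjugate in $B_n$). *)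

theory Defs
  imports "HOL-Algebra.Algebra" "Jordan_Normal_Form.DL_Rank"
begin

text \<open>A letter \<open>(True, x)\<close> stands for the generator \<open>x\<close>, a letter \<open>(False, x)\<close> for its
  formal inverse.\<close>

type_synonym 'a gword = "(bool \<times> 'a) list"

definition gwords :: "'a set \<Rightarrow> 'a gword set" where
  "gwords S = lists (UNIV \<times> S)"

text \<open>The least congruence on words over \<open>S\<close> that cancels mutually inverse letters and
  identifies \<open>u\<close> with \<open>v\<close> for every relation \<open>(u, v) \<in> R\<close>.\<close>

inductive pres_eq :: "'a set \<Rightarrow> ('a gword \<times> 'a gword) set \<Rightarrow> 'a gword \<Rightarrow> 'a gword \<Rightarrow> bool"
  for S R where
  refl: "u \<in> gwords S \<Longrightarrow> pres_eq S R u u"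
| sym: "pres_eq S R u v \<Longrightarrow> pres_eq S R v u"
| trans: "pres_eq S R u v \<Longrightarrow> pres_eq S R v w \<Longrightarrow> pres_eq S R u w"
| append: "pres_eq S R u u' \<Longrightarrow> pres_eq S R v v' \<Longrightarrow> pres_eq S R (u @ v) (u' @ v')"
| cancel: "x \<in> S \<Longrightarrow> pres_eq S R [(b, x), (\<not> b, x)] []"
| relation: "(u, v) \<in> R \<Longrightarrow> u \<in> gwords S \<Longrightarrow> v \<in> gwords S \<Longrightarrow> pres_eq S R u v"

definition pres_class :: "'a set \<Rightarrow> ('a gword \<times> 'a gword) set \<Rightarrow> 'a gword \<Rightarrow> 'a gword set" where
  "pres_class S R u = {v. pres_eq S R u v}"

definition presented_group ::
    "'a set \<Rightarrow> ('a gword \<times> 'a gword) set \<Rightarrow> 'a gword set monoid" where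
  "presented_group S R =
    \<lparr> partial_object.carrier = pres_class S R ` gwords S,
      monoid.mult = (\<lambda>A B. \<Union>u\<in>A. \<Union>v\<in>B. pres_class S R (u @ v)),
      monoid.one = pres_class S R [] \<rparr>"

lemma pres_eq_gwords: "pres_eq S R u v \<Longrightarrow> u \<in> gwords S \<and> v \<in> gwords S"
  by (induction rule: pres_eq.induct) (auto simp: gwords_def)

lemma pres_class_eq_iff:
  assumes "u \<in> gwords S"
  shows "pres_class S R u = pres_class S R v \<longleftrightarrow> pres_eq S R u v"
proof
  assume "pres_class S R u = pres_class S R v"
  with pres_eq.refl[OF assms, of R] have "pres_eq S R v u"
    unfolding pres_class_def by blast
  then show "pres_eq S R u v" by (rule pres_eq.sym)
next
  assume "pres_eq S R u v"
  then have "pres_eq S R u w \<longleftrightarrow> pres_eq S R v w" for w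
    using pres_eq.sym pres_eq.trans by metis
  then show "pres_class S R u = pres_class S R v"
    unfolding pres_class_def by (rule Collect_cong)
qed

lemma mult_pres_class:
  assumes "u \<in> gwords S" "v \<in> gwords S"
  shows "pres_class S R u \<otimes>\<^bsub>presented_group S R\<^esub> pres_class S R v = pres_class S R (u @ v)"
proof -
  have eq: "pres_class S R (u' @ v') = pres_class S R (u @ v)"
    if "u' \<in> pres_class S R u" "v' \<in> pres_class S R v" for u' v'
  proof -
    have "pres_eq S R (u @ v) (u' @ v')"
      using that by (auto simp: pres_class_def intro: pres_eq.append)
    then have "pres_class S R (u @ v) = pres_class S R (u' @ v')"
      using pres_class_eq_iff pres_eq_gwords by blast
    then show ?thesis by (rule HOL.sym)
  qed
  have mem: "u \<in> pres_class S R u" "v \<in> pres_class S R v"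
    using assms by (auto simp: pres_class_def intro: pres_eq.refl)
  have "(\<Union>u'\<in>pres_class S R u. \<Union>v'\<in>pres_class S R v. pres_class S R (u' @ v')) =
        (\<Union>u'\<in>pres_class S R u. \<Union>v'\<in>pres_class S R v. pres_class S R (u @ v))"
    by (intro SUP_cong HOL.refl eq)
  also have "\<dots> = pres_class S R (u @ v)"
    using mem by blast
  finally show ?thesis
    by (simp add: presented_group_def)
qed

lemma pres_eq_left_inverse:
  assumes "u \<in> gwords S"
  shows "pres_eq S R (map (\<lambda>(b, x). (\<not> b, x)) (rev u) @ u) []"
  using assms
proof (induction u)
  case Nil
  then show ?case by (auto intro: pres_eq.refl)
next
  case (Cons a u)
  obtain b x where a: "a = (b, x)" by fastforce
  let ?i = "map (\<lambda>(b, x). (\<not> b, x)) (rev u)"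
  have x: "x \<in> S" and u: "u \<in> gwords S" using Cons.prems by (auto simp: gwords_def a)
  have i: "?i \<in> gwords S" using u by (auto simp: gwords_def in_lists_conv_set)
  have "pres_eq S R ([(\<not> b, x), (b, x)] @ u) ([] @ u)"
    using pres_eq.cancel[OF x, of R "\<not> b"] pres_eq.refl[OF u] by (intro pres_eq.append) simp_all
  then have "pres_eq S R (?i @ ([(\<not> b, x), (b, x)] @ u)) (?i @ ([] @ u))"
    by (rule pres_eq.append[OF pres_eq.refl[OF i]])
  then have "pres_eq S R (?i @ ([(\<not> b, x), (b, x)] @ u)) []"
    by (rule pres_eq.trans) (use Cons.IH[OF u] in simp)
  then show ?case by (simp add: a)
qed

lemma group_presented_group: "group (presented_group S R)"
proof (rule groupI)
  let ?G = "presented_group S R"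
  have carrier: "carrier ?G = pres_class S R ` gwords S"
    and one: "\<one>\<^bsub>?G\<^esub> = pres_class S R []"
    by (simp_all add: presented_group_def)
  have app: "u @ v \<in> gwords S" if "u \<in> gwords S" "v \<in> gwords S" for u v
    using that by (auto simp: gwords_def)
  have nil: "[] \<in> gwords S" by (simp add: gwords_def)
  show "x \<otimes>\<^bsub>?G\<^esub> y \<in> carrier ?G" if "x \<in> carrier ?G" "y \<in> carrier ?G" for x y
    using that by (auto simp: carrier mult_pres_class app)
  show "\<one>\<^bsub>?G\<^esub> \<in> carrier ?G"
    using nil by (auto simp: carrier one)
  show "x \<otimes>\<^bsub>?G\<^esub> y \<otimes>\<^bsub>?G\<^esub> z = x \<otimes>\<^bsub>?G\<^esub> (y \<otimes>\<^bsub>?G\<^esub> z)"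
    if "x \<in> carrier ?G" "y \<in> carrier ?G" "z \<in> carrier ?G" for x y z
    using that by (auto simp: carrier mult_pres_class app)
  show "\<one>\<^bsub>?G\<^esub> \<otimes>\<^bsub>?G\<^esub> x = x" if "x \<in> carrier ?G" for x
    using that nil by (auto simp: carrier one mult_pres_class)
  show "\<exists>y\<in>carrier ?G. y \<otimes>\<^bsub>?G\<^esub> x = \<one>\<^bsub>?G\<^esub>" if x: "x \<in> carrier ?G" for x
  proof -
    obtain u where u: "u \<in> gwords S" and xu: "x = pres_class S R u"
      using x by (auto simp: carrier)
    let ?i = "map (\<lambda>(b, x). (\<not> b, x)) (rev u)"
    have i: "?i \<in> gwords S" using u by (auto simp: gwords_def in_lists_conv_set)
    have "pres_class S R ?i \<otimes>\<^bsub>?G\<^esub> x = \<one>\<^bsub>?G\<^esub>"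
      unfolding xu mult_pres_class[OF i u] one
      using pres_eq_left_inverse[OF u] pres_class_eq_iff[OF app[OF i u]] by blast
    then show ?thesis using i by (auto simp: carrier)
  qed
qed

definition braid_relations :: "nat \<Rightarrow> (nat gword \<times> nat gword) set" where
  "braid_relations n =
    {([(True, i), (True, j)], [(True, j), (True, i)]) | i j.
       i \<in> {1..n - 1} \<and> j \<in> {1..n - 1} \<and> \<bar>int i - int j\<bar> \<ge> 2} \<union>
    {([(True, i), (True, i + 1), (True, i)], [(True, i + 1), (True, i), (True, i + 1)]) | i.
       i \<in> {1..n - 2}}"

definition braid_group :: "nat \<Rightarrow> nat gword set monoid" where
  "braid_group n = presented_group {1..n - 1} (braid_relations n)"

definition braid_gen :: "nat \<Rightarrow> nat \<Rightarrow> nat gword set" where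
  "braid_gen n i = pres_class {1..n - 1} (braid_relations n) [(True, i)]"

lemma group_braid_group: "group (braid_group n)"
  unfolding braid_group_def by (rule group_presented_group)

definition GL :: "nat \<Rightarrow> complex mat monoid" where
  "GL r = units_of (ring_mat TYPE(complex) r ())"

definition matrix_rep :: "('g, 'm) monoid_scheme \<Rightarrow> nat \<Rightarrow> ('g \<Rightarrow> complex mat) \<Rightarrow> bool" where
  "matrix_rep G r \<rho> \<longleftrightarrow> \<rho> \<in> hom G (GL r)"

definition irreducible_rep :: "('g, 'm) monoid_scheme \<Rightarrow> nat \<Rightarrow> ('g \<Rightarrow> complex mat) \<Rightarrow> bool" where
  "irreducible_rep G r \<rho> \<longleftrightarrow>
    matrix_rep G r \<rho> \<and> r > 0 \<and>
    (\<forall>W. VectorSpace.subspace class_ring W (module_vec TYPE(complex) r) \<and>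
         (\<forall>g\<in>carrier G. \<forall>w\<in>W. \<rho> g *\<^sub>v w \<in> W) \<longrightarrow>
         W = {0\<^sub>v r} \<or> W = carrier_vec r)"

definition equivalent_reps ::
    "('g, 'm) monoid_scheme \<Rightarrow> nat \<Rightarrow> ('g \<Rightarrow> complex mat) \<Rightarrow> ('g \<Rightarrow> complex mat) \<Rightarrow> bool" where
  "equivalent_reps G r \<rho> \<sigma> \<longleftrightarrow>
    (\<exists>P\<in>carrier (GL r). \<forall>g\<in>carrier G. \<rho> g = P \<otimes>\<^bsub>GL r\<^esub> \<sigma> g \<otimes>\<^bsub>GL r\<^esub> inv\<^bsub>GL r\<^esub> P)"

definition kronecker_product :: "complex mat \<Rightarrow> complex mat \<Rightarrow> complex mat" where
  "kronecker_product A B =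
    mat (dim_row A * dim_row B) (dim_col A * dim_col B)
      (\<lambda>(i, j). A $$ (i div dim_row B, j div dim_col B) * B $$ (i mod dim_row B, j mod dim_col B))"

definition tensor_rep :: "('g \<Rightarrow> complex mat) \<Rightarrow> ('g \<Rightarrow> complex mat) \<Rightarrow> 'g \<Rightarrow> complex mat" where
  "tensor_rep \<rho> \<sigma> = (\<lambda>g. kronecker_product (\<rho> g) (\<sigma> g))"

definition corank :: "nat \<Rightarrow> nat \<Rightarrow> (nat gword set \<Rightarrow> complex mat) \<Rightarrow> nat" where
  "corank n r \<rho> = vec_space.rank r (\<rho> (braid_gen n 1) - 1\<^sub>m r)"

end

theory Submission
  imports Defs "HOL-Library.Function_Algebras"
    "HOL-Computational_Algebra.Fundamental_Theorem_Algebra"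
begin

text \<open>Let \<open>s\<^sub>0, \<dots>, s\<^sub>q\<^sub>-\<^sub>1\<close> with \<open>q = n - 1\<close> be the images of the generators. For \<open>q \<ge> 4\<close> the ideal
  \<open>J\<close> generated by the differences \<open>s\<^sub>i - s\<^sub>j\<close> is idempotent; call a module \<open>V\<close> perfect if \<open>J V = V\<close>.
  The subgroup generated by \<open>s\<^sub>2, \<dots>, s\<^sub>q\<^sub>-\<^sub>1\<close> commutes with \<open>s\<^sub>0\<close>, and if \<open>V\<close> has less than twice the
  least dimension of a nonzero perfect module of that subgroup, then \<open>s\<^sub>0\<close> acts on the perfect part of
  \<open>V\<close> for that subgroup as a scalar \<open>c\<close>. Thus \<open>a\<^sub>0 (s\<^sub>i - s\<^sub>j) = 0\<close> for \<open>i, j \<ge> 2\<close>, where \<open>a\<^sub>i = s\<^sub>i - c\<close>.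
  Conjugating by \<open>\<delta> = s\<^sub>0 \<dots> s\<^sub>q\<^sub>-\<^sub>1\<close>, whose powers permute the generators cyclically with the help of one
  additional element, shows that all products \<open>a\<^sub>i a\<^sub>j\<close> with \<open>\<bar>i - j\<bar> \<ge> 2\<close> coincide. Their common value is
  central and annihilates the differences, so it vanishes on a perfect module.

  Put \<open>U\<^sub>i = a\<^sub>i V\<close>. Since \<open>a\<^sub>i\<^sub>-\<^sub>1\<close> kills \<open>U\<^sub>j\<close> for \<open>j > i\<close> but not \<open>U\<^sub>i\<close>, the sums
  \<open>U\<^sub>i + \<dots> + U\<^sub>q\<^sub>-\<^sub>1\<close> strictly decrease for \<open>i \<ge> 1\<close>. This bounds the dimension of perfect modules from below
  by \<open>q - 1\<close>, which closes an induction in steps of two, and together with the intersections of the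
  \<open>U\<^sub>i\<close> it bounds the corank of \<open>s\<^sub>i / c\<close>.\<close>

section \<open>Finite-dimensional subspaces and eigenvectors\<close>

locale complex_vector_space = vector_space scale
  for scale :: "complex \<Rightarrow> 'b::ab_group_add \<Rightarrow> 'b" (infixr \<open>*s\<close> 75)
begin

sublocale endo: vector_space_pair scale scale
  by unfold_locales

abbreviation endomorphism :: "('b \<Rightarrow> 'b) \<Rightarrow> bool" where
  "endomorphism f \<equiv> Vector_Spaces.linear scale scale f"

text \<open>The ambient type may be infinite-dimensional, so finiteness is a property of the
  individual subspaces.\<close>

definition findim :: "'b set \<Rightarrow> bool" where
  "findim M \<longleftrightarrow> subspace M \<and> (\<exists>B. finite B \<and> M \<subseteq> span B)"

lemma findim_subspace: "findim M \<Longrightarrow> subspace M"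
  by (simp add: findim_def)

lemma findim_mono: "findim Y \<Longrightarrow> M \<subseteq> Y \<Longrightarrow> subspace M \<Longrightarrow> findim M"
  unfolding findim_def by blast

lemma findim_independent_finite:
  "findim M \<Longrightarrow> B \<subseteq> M \<Longrightarrow> independent B \<Longrightarrow> finite B"
  unfolding findim_def using independent_span_bound by blast

lemma findim_extend_basis:
  assumes "findim Y" "B \<subseteq> Y" "independent B"
  obtains C where "B \<subseteq> C" "C \<subseteq> Y" "finite C" "independent C" "span C = Y" "card C = dim Y"
proof -
  obtain C where C: "B \<subseteq> C" "C \<subseteq> Y" "independent C" "Y \<subseteq> span C"
    using maximal_independent_subset_extend[OF assms(2,3)] by blast
  have "span C = Y"
    using C span_minimal[OF C(2)] assms(1) by (auto simp: findim_def)
  moreover have "finite C" using findim_independent_finite[OF assms(1) C(2,3)] .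
  ultimately show ?thesis
    using that[OF C(1,2) _ C(3)] basis_card_eq_dim[OF C(2,4,3)] by simp
qed

lemma findim_basis:
  assumes "findim M"
  obtains B where "B \<subseteq> M" "finite B" "independent B" "span B = M" "card B = dim M"
  using findim_extend_basis[OF assms empty_subsetI independent_empty] by blast

lemma dim_subspace_mono:
  assumes "findim Y" "subspace M" "M \<subseteq> Y"
  shows "dim M \<le> dim Y"
proof -
  obtain B where B: "B \<subseteq> M" "finite B" "independent B" "span B = M" "card B = dim M"
    using findim_basis[OF findim_mono[OF assms(1,3,2)]] by blast
  obtain C where C: "B \<subseteq> C" "finite C" "card C = dim Y"
    using findim_extend_basis[OF assms(1) order_trans[OF B(1) assms(3)] B(3)] by blast
  show ?thesis using card_mono[OF C(2,1)] B C by simp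
qed

lemma findim_subspace_eqI:
  assumes "findim Y" "subspace M" "M \<subseteq> Y" "dim Y \<le> dim M"
  shows "M = Y"
proof -
  obtain B where B: "B \<subseteq> M" "finite B" "independent B" "span B = M" "card B = dim M"
    using findim_basis[OF findim_mono[OF assms(1,3,2)]] by blast
  obtain C where C: "B \<subseteq> C" "finite C" "card C = dim Y" "span C = Y"
    using findim_extend_basis[OF assms(1) order_trans[OF B(1) assms(3)] B(3)] by blast
  have "B = C" using B C assms(4) by (intro card_seteq) auto
  then show ?thesis using B C by simp
qed

lemma dim_psubspace:
  "findim Y \<Longrightarrow> subspace M \<Longrightarrow> M \<subset> Y \<Longrightarrow> dim M < dim Y"
  using findim_subspace_eqI[of Y M] by (metis not_le psubset_eq)

lemma dim_zero [simp]: "dim {0} = 0"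
  using dim_unique[of "{}" "{0}" 0] independent_empty by simp

lemma findim_dim_0: "findim M \<Longrightarrow> dim M = 0 \<longleftrightarrow> M = {0}"
  using findim_subspace_eqI[of M "{0}"] subspace_0[of M] by (auto simp: findim_def)

lemma findim_image:
  assumes "endomorphism f" "findim M"
  shows "findim (f ` M)"
proof -
  obtain B where B: "finite B" "M \<subseteq> span B" using assms by (auto simp: findim_def)
  then have "f ` M \<subseteq> span (f ` B)"
    using endo.linear_span_image[OF assms(1), of B] by auto
  then show ?thesis using B assms endo.linear_subspace_image
    unfolding findim_def by blast
qed

section \<open>Rank-nullity and the dimension formula for sums of subspaces\<close>

lemma span_inter_complement:
  assumes "independent C" "B \<subseteq> C" "x \<in> span B" "x \<in> span (C - B)"
  shows "x = 0"
proof -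
  have ind: "independent B" "independent (C - B)"
    using assms independent_mono by blast+
  have 1: "representation C x = representation B x"
    using assms by (intro representation_extend) auto
  have 2: "representation C x = representation (C - B) x"
    using assms by (intro representation_extend) auto
  have "representation C x b = 0" for b
    using 1 2 representation_ne_zero[of B x b] representation_ne_zero[of "C - B" x b] by fastforce
  moreover have "x \<in> span C" using assms span_mono by blast
  ultimately show ?thesis
    using sum_nonzero_representation_eq[OF assms(1)] by fastforce
qed

text \<open>A basis of the kernel is extended to a basis \<open>C\<close> of \<open>M\<close>. The
  added vectors span a complement on which \<open>f\<close> is injective, so their images form a
  basis of the image.\<close>

lemma rank_nullity:
  assumes f: "endomorphism f" and M: "findim M"
  shows "dim M = dim (f ` M) + dim {x \<in> M. f x = 0}"
proof -
  define K where "K = {x \<in> M. f x = 0}"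
  have "subspace {x. f x = 0}" using endo.linear_subspace_kernel[OF f] .
  then have subK: "subspace K"
    unfolding K_def Collect_conj_eq Collect_mem_eq
    by (rule subspace_inter[OF findim_subspace[OF M]])
  have K: "findim K" by (rule findim_mono[OF M _ subK]) (auto simp: K_def)
  obtain B where B: "B \<subseteq> K" "finite B" "independent B" "span B = K" "card B = dim K"
    using findim_basis[OF K] by blast
  obtain C where C: "B \<subseteq> C" "C \<subseteq> M" "finite C" "independent C" "span C = M" "card C = dim M"
    using findim_extend_basis[OF M _ B(3)] B(1) K_def by blast
  let ?D = "C - B"
  have inj: "inj_on f (span ?D)"
  proof (rule inj_onI)
    fix x y assume xy: "x \<in> span ?D" "y \<in> span ?D" "f x = f y"
    have d: "x - y \<in> span ?D" using xy span_diff by blast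
    then have "x - y \<in> M" using C span_mono[of ?D C] by auto
    moreover have "f (x - y) = 0" using xy endo.linear_diff[OF f] by simp
    ultimately have "x - y \<in> span B" by (simp add: B K_def)
    then show "x = y" using span_inter_complement[OF C(4,1) _ d] by simp
  qed
  have ind: "independent (f ` ?D)"
    using endo.linear_independent_injective_image[OF f _ inj] C(4) independent_mono by blast
  have "f ` M = span (f ` C)" using endo.linear_span_image[OF f, of C] C by simp
  also have "\<dots> = span (f ` ?D)"
  proof (rule antisym)
    have "f b = 0" if "b \<in> B" for b using that B K_def by auto
    then have "f ` C \<subseteq> insert 0 (f ` ?D)" by auto
    then show "span (f ` C) \<subseteq> span (f ` ?D)"
      using span_mono[of "f ` C" "insert 0 (f ` ?D)"] by simp
    show "span (f ` ?D) \<subseteq> span (f ` C)" by (rule span_mono) auto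
  qed
  finally have "dim (f ` M) = card (f ` ?D)" using dim_span_eq_card_independent[OF ind] by simp
  also have "\<dots> = card ?D"
    by (rule card_image[OF inj_on_subset[OF inj span_superset]])
  also have "\<dots> = dim M - dim K"
    unfolding card_Diff_subset[OF B(2) C(1)] using C B by simp
  finally show ?thesis
    using dim_subspace_mono[OF M subK] by (simp add: K_def)
qed

text \<open>Kill a basis of \<open>S\<close> and fix the other vectors of a basis of the whole
  space. The map stands in for the quotient map in \<open>dim_span_Un_Int\<close>.\<close>

lemma ex_endomorphism_with_kernel:
  assumes "subspace S"
  obtains g where "endomorphism g" "\<And>x. g x = 0 \<longleftrightarrow> x \<in> S"
proof -
  obtain B where B: "B \<subseteq> S" "independent B" "S \<subseteq> span B"
    using maximal_independent_subset[of S] .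
  obtain g where g: "endomorphism g" "\<forall>x\<in>extend_basis B. g x = (if x \<in> B then 0 else x)"
    using endo.linear_independent_extend[OF independent_extend_basis[OF B(2)],
        of "\<lambda>x. if x \<in> B then 0 else x"] by auto
  have BE: "B \<subseteq> extend_basis B" using extend_basis_superset[OF B(2)] .
  have diff: "x - g x \<in> S" for x
  proof -
    have "x \<in> span (extend_basis B)" using span_extend_basis[OF B(2)] by simp
    then show ?thesis
    proof (induct rule: span_induct_alt)
      case base
      show ?case using assms subspace_0 endo.linear_0[OF g(1)] by simp
    next
      case (step c x y)
      have "x - g x \<in> S" using g(2) step(1) B(1) assms subspace_0 by auto
      then have "c *s (x - g x) + (y - g y) \<in> S"
        using step(2) subspace_add[OF assms] subspace_scale[OF assms] by blast
      moreover have "c *s x + y - g (c *s x + y) = c *s (x - g x) + (y - g y)"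
        using endo.linear_add[OF g(1)] endo.linear_scale[OF g(1)]
        by (simp add: scale_right_diff_distrib)
      ultimately show ?case by (simp only:)
    qed
  qed
  have "g x = 0" if "x \<in> S" for x
  proof -
    have "x \<in> span B" using that B(3) by (rule rev_subsetD)
    then show ?thesis
    proof (induct rule: span_induct_alt)
      case base
      show ?case using endo.linear_0[OF g(1)] .
    next
      case (step c x y)
      then show ?case
        using endo.linear_add[OF g(1)] endo.linear_scale[OF g(1)] g(2) BE by auto
    qed
  qed
  then show ?thesis using that[OF g(1)] diff by (metis diff_0_right)
qed

lemma findim_span_Un:
  assumes "findim S" "findim T"
  shows "findim (span (S \<union> T))"
proof -
  obtain B C where "finite B" "S \<subseteq> span B" "finite C" "T \<subseteq> span C"
    using assms by (auto simp: findim_def)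
  then have "finite (B \<union> C)" "S \<union> T \<subseteq> span (B \<union> C)"
    using span_mono[of B "B \<union> C"] span_mono[of C "B \<union> C"] by auto
  then show ?thesis unfolding findim_def
    using span_minimal subspace_span by blast
qed

text \<open>Rank-nullity for a map with kernel \<open>S\<close>, on \<open>S + T\<close> and on
  \<open>T\<close>: the images agree, and the kernels are \<open>S\<close> and
  \<open>S \<inter> T\<close>.\<close>

lemma dim_span_Un_Int:
  assumes "findim S" "findim T"
  shows "dim (span (S \<union> T)) + dim (S \<inter> T) = dim S + dim T"
proof -
  note sub = findim_subspace[OF assms(1)] findim_subspace[OF assms(2)]
  obtain g where g: "endomorphism g" "\<And>x. g x = 0 \<longleftrightarrow> x \<in> S"
    using ex_endomorphism_with_kernel[OF sub(1)] by blast
  have "g ` span (S \<union> T) = span (g ` S \<union> g ` T)"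
    using endo.linear_span_image[OF g(1), of "S \<union> T"] by (simp add: image_Un)
  also have "g ` S \<union> g ` T = g ` T"
  proof -
    have "g ` S \<subseteq> {0}" using g(2) by auto
    moreover have "0 \<in> g ` T"
      using subspace_0[OF sub(2)] endo.linear_0[OF g(1)] by (metis image_eqI)
    ultimately show ?thesis by auto
  qed
  also have "span (g ` T) = g ` T"
    using endo.linear_subspace_image[OF g(1) sub(2)] span_eq_iff by blast
  finally have img: "g ` span (S \<union> T) = g ` T" .
  have "{x \<in> span (S \<union> T). g x = 0} = S" using g(2) span_superset[of "S \<union> T"] by auto
  moreover have "{x \<in> T. g x = 0} = S \<inter> T" using g(2) by auto
  ultimately show ?thesis
    using rank_nullity[OF g(1) findim_span_Un[OF assms]] rank_nullity[OF g(1) assms(2)] img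
    by simp
qed

section \<open>Polynomials in an endomorphism and the existence of eigenvectors\<close>

definition poly_apply :: "complex poly \<Rightarrow> ('b \<Rightarrow> 'b) \<Rightarrow> 'b \<Rightarrow> 'b" where
  "poly_apply p f v = fold_coeffs (\<lambda>a w. a *s v + f w) p 0"

context
  fixes f :: "'b \<Rightarrow> 'b"
  assumes f: "endomorphism f"
begin

lemma poly_apply_0 [simp]: "poly_apply 0 f v = 0"
  by (simp add: poly_apply_def)

lemma poly_apply_pCons [simp]: "poly_apply (pCons a p) f v = a *s v + f (poly_apply p f v)"
  by (cases "a = 0 \<and> p = 0") (auto simp: poly_apply_def endo.linear_0[OF f])

lemma poly_apply_add: "poly_apply (p + q) f v = poly_apply p f v + poly_apply q f v"
proof (induction p arbitrary: q)
  case 0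
  show ?case by simp
next
  case (pCons a p)
  obtain b r where q: "q = pCons b r" by (cases q)
  have "poly_apply (pCons a p + q) f v = (a + b) *s v + f (poly_apply (p + r) f v)"
    unfolding q add_pCons poly_apply_pCons ..
  also have "\<dots> = (a *s v + b *s v) + (f (poly_apply p f v) + f (poly_apply r f v))"
    unfolding pCons.IH scale_left_distrib endo.linear_add[OF f] ..
  also have "\<dots> = (a *s v + f (poly_apply p f v)) + (b *s v + f (poly_apply r f v))"
    by (simp only: add_ac)
  finally show ?case unfolding q poly_apply_pCons .
qed

lemma poly_apply_smult: "poly_apply (smult c p) f v = c *s poly_apply p f v"
  by (induction p) (simp_all add: endo.linear_scale[OF f] scale_right_distrib)

lemma poly_apply_in: "subspace M \<Longrightarrow> f ` M \<subseteq> M \<Longrightarrow> v \<in> M \<Longrightarrow> poly_apply p f v \<in> M"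
  by (induction p) (auto intro!: subspace_0 subspace_add subspace_scale)

lemma poly_apply_root: "poly_apply ([:- c, 1:] * q) f v = f (poly_apply q f v) - c *s poly_apply q f v"
proof -
  have "poly_apply ([:- c, 1:] * q) f v = poly_apply (smult (- c) q + pCons 0 q) f v" by simp
  also have "\<dots> = (- c) *s poly_apply q f v + f (poly_apply q f v)"
    unfolding poly_apply_add poly_apply_smult by simp
  finally show ?thesis by simp
qed

lemma poly_apply_monom: "poly_apply (monom 1 d) f v = (f ^^ d) v"
proof (induction d)
  case 0
  show ?case by (simp add: monom_0 endo.linear_0[OF f])
qed (simp add: monom_Suc)

lemma ex_annihilating_poly:
  assumes M: "findim M" and fM: "f ` M \<subseteq> M" and v: "v \<in> M"
  obtains p where "p \<noteq> 0" "poly_apply p f v = 0"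
proof -
  define w where "w i = (f ^^ i) v" for i
  have wM: "w i \<in> M" for i
    by (induction i) (use fM v in \<open>auto simp: w_def\<close>)
  \<comment> \<open>Otherwise all iterates of \<open>v\<close> are independent, which a finite
    spanning set of \<open>M\<close> forbids.\<close>
  have "\<exists>d. w d \<in> span (w ` {..<d})"
  proof (rule ccontr)
    assume not: "\<nexists>d. w d \<in> span (w ` {..<d})"
    have "independent (w ` {..<d}) \<and> card (w ` {..<d}) = d" for d
    proof (induction d)
      case (Suc d)
      have d: "w d \<notin> span (w ` {..<d})" using not by (rule not_ex[THEN iffD1, THEN spec])
      then have "w d \<notin> w ` {..<d}" by (rule contra_subsetD[OF span_superset])
      moreover have "independent (insert (w d) (w ` {..<d}))"
        using independent_insertI[OF d] Suc by simp
      ultimately show ?case using Suc by (simp add: lessThan_Suc)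
    qed (simp add: independent_empty)
    moreover obtain C where "finite C" and "M \<subseteq> span C" using M by (auto simp: findim_def)
    moreover have "w ` {..<Suc (card C)} \<subseteq> span C"
      using wM \<open>M \<subseteq> span C\<close> by auto
    ultimately have "Suc (card C) \<le> card C"
      using independent_span_bound[of C "w ` {..<Suc (card C)}"] by simp
    then show False by simp
  qed
  then obtain d where d: "w d \<in> span (w ` {..<d})" by blast
  \<comment> \<open>Values at \<open>v\<close> of the polynomials of degree less than
    \<open>d\<close>; they form a subspace containing the first \<open>d\<close> iterates.\<close>
  let ?P = "{poly_apply p f v | p. \<forall>i\<ge>d. coeff p i = 0}"
  have "subspace ?P"
  proof (rule subspaceI)
    show "0 \<in> ?P" by (rule CollectI, rule exI[of _ 0]) simp
  next
    fix x y assume "x \<in> ?P" "y \<in> ?P"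
    then obtain p q where "x = poly_apply p f v" "\<forall>i\<ge>d. coeff p i = 0"
      "y = poly_apply q f v" "\<forall>i\<ge>d. coeff q i = 0" by blast
    then show "x + y \<in> ?P"
      by (intro CollectI exI[of _ "p + q"]) (simp add: poly_apply_add)
  next
    fix c x assume "x \<in> ?P"
    then obtain p where "x = poly_apply p f v" "\<forall>i\<ge>d. coeff p i = 0" by blast
    then show "c *s x \<in> ?P"
      by (intro CollectI exI[of _ "smult c p"]) (simp add: poly_apply_smult)
  qed
  moreover have "w ` {..<d} \<subseteq> ?P"
  proof
    fix x assume "x \<in> w ` {..<d}"
    then obtain i where "i < d" "x = w i" by blast
    then show "x \<in> ?P"
      by (intro CollectI exI[of _ "monom 1 i"]) (auto simp: poly_apply_monom w_def)
  qed
  ultimately have "w d \<in> ?P" using d span_minimal by blast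
  then obtain p where p: "w d = poly_apply p f v" "\<forall>i\<ge>d. coeff p i = 0" by blast
  let ?q = "monom 1 d + smult (-1) p"
  have "coeff ?q d = 1" using p by simp
  then have "?q \<noteq> 0" by (metis coeff_0 zero_neq_one)
  moreover have "poly_apply ?q f v = 0"
    unfolding poly_apply_add poly_apply_smult poly_apply_monom using p by (simp add: w_def)
  ultimately show ?thesis using that by blast
qed

text \<open>Induction on the degree of a polynomial \<open>p\<close> that annihilates a nonzero
  \<open>v\<close>. Split off a root as \<open>p = (X - c) q\<close>: either \<open>q\<close>
  already annihilates \<open>v\<close>, or \<open>q\<close> evaluated at \<open>f\<close> sends
  \<open>v\<close> to an eigenvector for \<open>c\<close>.\<close>

lemma ex_eigenvector:
  assumes M: "findim M" "M \<noteq> {0}" and fM: "f ` M \<subseteq> M"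
  obtains c v where "v \<in> M" "v \<noteq> 0" "f v = c *s v"
proof -
  have ex: "\<exists>c v. v \<in> M \<and> v \<noteq> 0 \<and> f v = c *s v"
    if "p \<noteq> 0" "v \<in> M" "v \<noteq> 0" "poly_apply p f v = 0" for p v
    using that
  proof (induction "degree p" arbitrary: p)
    case 0
    then obtain a where "p = [:a:]" "a \<noteq> 0" using degree_eq_zeroE by (metis pCons_0_0)
    then have "poly_apply p f v = a *s v" by (simp add: endo.linear_0[OF f])
    then show ?case using 0 \<open>a \<noteq> 0\<close> by simp
  next
    case (Suc d)
    have "\<not> constant (poly p)" using Suc(2) constant_degree[of p] by linarith
    then obtain c where "poly p c = 0" using fundamental_theorem_of_algebra by blast
    then obtain q where q: "p = [:- c, 1:] * q" using poly_eq_0_iff_dvd by blast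
    then have "q \<noteq> 0" using Suc by auto
    then have "degree p = Suc (degree q)" unfolding q by (subst degree_mult_eq) auto
    then have deg: "d = degree q" using Suc by simp
    show ?case
    proof (cases "poly_apply q f v = 0")
      case True
      show ?thesis by (rule Suc(1)[OF deg \<open>q \<noteq> 0\<close> Suc(4,5) True])
    next
      case False
      have "f (poly_apply q f v) = c *s poly_apply q f v"
        using Suc(6) unfolding q poly_apply_root by simp
      then show ?thesis
        using False poly_apply_in[OF findim_subspace[OF M(1)] fM Suc(4)]
        by (intro exI[of _ c] exI[of _ "poly_apply q f v"]) simp
    qed
  qed
  obtain v where v: "v \<in> M" "v \<noteq> 0" using M findim_subspace subspace_0 by blast
  obtain p where "p \<noteq> 0" "poly_apply p f v = 0" using ex_annihilating_poly[OF M(1) fM v(1)] .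
  then show ?thesis using ex[of p v] v that by blast
qed

end

end

section \<open>Perfect braid modules\<close>

context complex_vector_space
begin

lemma endomorphism_sub_scale: "endomorphism f \<Longrightarrow> endomorphism (\<lambda>x. f x - c *s x)"
  by (intro endo.linear_compose_sub linear_scale_self)

lemma endomorphism_surj_on:
  assumes f: "endomorphism f" and M: "findim M"
    and st: "\<And>x. x \<in> M \<Longrightarrow> f x \<in> M" and inj: "\<And>x. x \<in> M \<Longrightarrow> f x = 0 \<Longrightarrow> x = 0"
  shows "f ` M = M"
proof (rule findim_subspace_eqI[OF M])
  show "subspace (f ` M)" using endo.linear_subspace_image[OF f findim_subspace[OF M]] .
  show "f ` M \<subseteq> M" using st by auto
  have "{x \<in> M. f x = 0} = {0}"
    using inj subspace_0[OF findim_subspace[OF M]] endo.linear_0[OF f] by auto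
  then show "dim M \<le> dim (f ` M)" using rank_nullity[OF f M] by simp
qed

text \<open>Where the generators act injectively on a finite-dimensional space, closure under their
  inverses follows, see \<open>generator_submodule\<close>.\<close>

definition submodule :: "nat \<Rightarrow> (nat \<Rightarrow> 'b \<Rightarrow> 'b) \<Rightarrow> 'b set \<Rightarrow> 'b set \<Rightarrow> bool" where
  "submodule q \<sigma> V W \<longleftrightarrow> subspace W \<and> W \<subseteq> V \<and> (\<forall>i<q. \<forall>x\<in>W. \<sigma> i x \<in> W)"

text \<open>For a submodule \<open>W\<close> of a module \<open>V\<close>: all generators induce the
  same operator on \<open>V / W\<close>, equivalently \<open>W\<close> contains
  \<open>J V\<close>.\<close>

definition absorbs_differences :: "nat \<Rightarrow> (nat \<Rightarrow> 'b \<Rightarrow> 'b) \<Rightarrow> 'b set \<Rightarrow> 'b set \<Rightarrow> bool" where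
  "absorbs_differences q \<sigma> V W \<longleftrightarrow> (\<forall>i<q. \<forall>j<q. \<forall>x\<in>V. \<sigma> i x - \<sigma> j x \<in> W)"

text \<open>For a module \<open>V\<close> this is \<open>J V\<close>, obtained as the least
  submodule absorbing the differences, so that no ideal has to be formed.\<close>

definition core :: "nat \<Rightarrow> (nat \<Rightarrow> 'b \<Rightarrow> 'b) \<Rightarrow> 'b set \<Rightarrow> 'b set" where
  "core q \<sigma> V = \<Inter>{W. submodule q \<sigma> V W \<and> absorbs_differences q \<sigma> V W}"

definition perfect :: "nat \<Rightarrow> (nat \<Rightarrow> 'b \<Rightarrow> 'b) \<Rightarrow> 'b set \<Rightarrow> bool" where
  "perfect q \<sigma> V \<longleftrightarrow> (\<forall>W. submodule q \<sigma> V W \<longrightarrow> absorbs_differences q \<sigma> V W \<longrightarrow> W = V)"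

lemma perfectD: "perfect q \<sigma> V \<Longrightarrow> submodule q \<sigma> V W \<Longrightarrow> absorbs_differences q \<sigma> V W \<Longrightarrow> W = V"
  by (simp add: perfect_def)

lemma submoduleD:
  assumes "submodule q \<sigma> V W"
  shows "subspace W" "W \<subseteq> V" "i < q \<Longrightarrow> x \<in> W \<Longrightarrow> \<sigma> i x \<in> W"
  using assms by (auto simp: submodule_def)

lemma absorbs_differencesD:
  "absorbs_differences q \<sigma> V W \<Longrightarrow> i < q \<Longrightarrow> j < q \<Longrightarrow> x \<in> V \<Longrightarrow> \<sigma> i x - \<sigma> j x \<in> W"
  by (auto simp: absorbs_differences_def)

lemma submodule_core:
  assumes "submodule q \<sigma> V V"
  shows "submodule q \<sigma> V (core q \<sigma> V)" and "absorbs_differences q \<sigma> V (core q \<sigma> V)"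
proof -
  let ?C = "{W. submodule q \<sigma> V W \<and> absorbs_differences q \<sigma> V W}"
  have "absorbs_differences q \<sigma> V V"
    using submoduleD(3)[OF assms] subspace_diff[OF submoduleD(1)[OF assms]]
    by (simp add: absorbs_differences_def)
  then have V: "V \<in> ?C" using assms by simp
  have "subspace (\<Inter>?C)"
    by (rule subspace_Inter) (simp add: submodule_def)
  moreover have "\<Inter>?C \<subseteq> V" using V by (rule Inter_lower)
  ultimately show "submodule q \<sigma> V (core q \<sigma> V)"
    unfolding core_def submodule_def[of q \<sigma> V "\<Inter>_"] by (auto simp: submodule_def)
  show "absorbs_differences q \<sigma> V (core q \<sigma> V)"
    unfolding core_def absorbs_differences_def by (auto simp: absorbs_differences_def)
qed

lemma core_least: "submodule q \<sigma> V W \<Longrightarrow> absorbs_differences q \<sigma> V W \<Longrightarrow> core q \<sigma> V \<subseteq> W"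
  unfolding core_def by (rule Inter_lower) simp

lemma submodule_trans: "submodule q \<sigma> V W \<Longrightarrow> submodule q \<sigma> W Y \<Longrightarrow> submodule q \<sigma> V Y"
  by (auto simp: submodule_def)

lemma submodule_image:
  assumes N: "endomorphism N" and M: "subspace M" and st: "\<And>i x. i < p \<Longrightarrow> x \<in> M \<Longrightarrow> \<tau> i x \<in> M"
    and comm: "\<And>i x. i < p \<Longrightarrow> x \<in> M \<Longrightarrow> N (\<tau> i x) = \<tau> i (N x)" and NY: "N ` M \<subseteq> Y"
  shows "submodule p \<tau> Y (N ` M)"
  unfolding submodule_def
proof (intro conjI allI impI ballI)
  show "subspace (N ` M)" using endo.linear_subspace_image[OF N M] .
  show "N ` M \<subseteq> Y" using NY .
  fix i y assume i: "i < p" and "y \<in> N ` M"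
  then obtain x where "x \<in> M" "y = N x" by auto
  then have "\<tau> i y = N (\<tau> i x)" "\<tau> i x \<in> M" using comm[OF i] st[OF i] by simp_all
  then show "\<tau> i y \<in> N ` M" by simp
qed

text \<open>A submodule of the image that absorbs differences pulls back along \<open>N\<close> to
  such a submodule of \<open>M\<close>, hence to all of \<open>M\<close>.\<close>

lemma perfect_image:
  assumes \<tau>: "\<And>i. endomorphism (\<tau> i)" and N: "endomorphism N"
    and M: "subspace M" and st: "\<And>i x. i < p \<Longrightarrow> x \<in> M \<Longrightarrow> \<tau> i x \<in> M"
    and comm: "\<And>i x. i < p \<Longrightarrow> x \<in> M \<Longrightarrow> N (\<tau> i x) = \<tau> i (N x)"
    and perf: "perfect p \<tau> M"
  shows "perfect p \<tau> (N ` M)"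
  unfolding perfect_def
proof (intro allI impI)
  fix W assume W: "submodule p \<tau> (N ` M) W" and D: "absorbs_differences p \<tau> (N ` M) W"
  let ?W = "{x \<in> M. N x \<in> W}"
  note Ws = submoduleD[OF W]
  have "submodule p \<tau> M ?W"
    unfolding submodule_def
  proof (intro conjI allI impI ballI)
    show "subspace ?W"
      by (rule subspaceI)
        (auto simp: endo.linear_0[OF N] endo.linear_add[OF N] endo.linear_scale[OF N]
          subspace_0[OF M] subspace_0[OF Ws(1)] subspace_add[OF M] subspace_add[OF Ws(1)]
          subspace_scale[OF M] subspace_scale[OF Ws(1)])
    fix i x assume "i < p" "x \<in> ?W"
    then show "\<tau> i x \<in> ?W" using st comm Ws(3) by simp
  qed auto
  moreover have "absorbs_differences p \<tau> M ?W"
    unfolding absorbs_differences_def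
  proof (intro allI impI ballI)
    fix i j x assume "i < p" "j < p" "x \<in> M"
    then show "\<tau> i x - \<tau> j x \<in> ?W"
      using absorbs_differencesD[OF D, of i j "N x"]
      by (simp add: endo.linear_diff[OF N] comm st subspace_diff[OF M])
  qed
  ultimately have "?W = M" using perfectD[OF perf] by simp
  then show "W = N ` M" using Ws(2) by auto
qed

text \<open>If the range of \<open>N = c - l\<close> were nonzero on \<open>M\<close>, induction makes \<open>c\<close> a scalar \<open>m\<close> there;
  then a nonzero perfect module, the range of \<open>N\<close> if \<open>m = l\<close> and that of \<open>c - m\<close> otherwise,
  lies in the kernel of \<open>N\<close>, and rank-nullity gives dimension at least \<open>2 * s\<close>.\<close>

lemma centralizer_scalar:
  assumes \<tau>: "\<And>i. endomorphism (\<tau> i)" and c: "endomorphism c"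
    and "findim M" and "perfect p \<tau> M"
    and "\<And>i x. i < p \<Longrightarrow> x \<in> M \<Longrightarrow> \<tau> i x \<in> M"
    and "\<And>x. x \<in> M \<Longrightarrow> c x \<in> M"
    and "\<And>i x. i < p \<Longrightarrow> x \<in> M \<Longrightarrow> c (\<tau> i x) = \<tau> i (c x)"
    and "\<And>Y. submodule p \<tau> M Y \<Longrightarrow> perfect p \<tau> Y \<Longrightarrow> Y \<noteq> {0} \<Longrightarrow> s \<le> dim Y"
    and "dim M < 2 * s"
  shows "\<exists>l. \<forall>x\<in>M. c x = l *s x"
  using assms(3-)
proof (induction "dim M" arbitrary: M rule: less_induct)
  case less
  note M = less.prems(1) and perf = less.prems(2) and st = less.prems(3) and cM = less.prems(4)
    and comm = less.prems(5) and big = less.prems(6) and small = less.prems(7)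
  note subM = findim_subspace[OF M]
  show ?case
  proof (cases "M = {0}")
    case True
    then show ?thesis using endo.linear_0[OF c] by simp
  next
    case False
    obtain l v where v: "v \<in> M" "v \<noteq> 0" "c v = l *s v"
      using ex_eigenvector[OF c M False image_subsetI] cM by metis
    define shift where "shift m x = c x - m *s x" for m x
    have sh: "endomorphism (shift m)" for m
      unfolding shift_def[abs_def] by (rule endomorphism_sub_scale[OF c])
    have shM: "shift m x \<in> M" if "x \<in> M" for m x
      using that cM subspace_diff[OF subM] subspace_scale[OF subM] by (simp add: shift_def)
    have shcomm: "shift m (\<tau> i x) = \<tau> i (shift m x)" if "i < p" "x \<in> M" for m i x
      using comm[OF that] endo.linear_diff[OF \<tau>] endo.linear_scale[OF \<tau>] by (simp add: shift_def)
    have shsh: "shift m (shift k x) = shift k (shift m x)" for m k x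
      unfolding shift_def endo.linear_diff[OF c] endo.linear_scale[OF c]
        scale_right_diff_distrib scale_scale mult.commute[of m k] by (simp add: algebra_simps)
    let ?I = "\<lambda>m. shift m ` M"
    have subI: "submodule p \<tau> M (?I m)" for m
      by (rule submodule_image[OF sh subM]) (auto simp: st shcomm shM)
    have perfI: "perfect p \<tau> (?I m)" for m
      by (rule perfect_image[OF \<tau> sh subM _ _ perf]) (auto simp: st shcomm)
    have bigI: "s \<le> dim (?I m)" if "?I m \<noteq> {0}" for m
      using big[OF subI perfI that] .
    let ?K = "{x \<in> M. shift l x = 0}"
    have rn: "dim M = dim (?I l) + dim ?K" using rank_nullity[OF sh M] .
    have subK: "subspace ?K"
      using subspace_inter[OF subM endo.linear_subspace_kernel[OF sh[of l]]]
      by (simp add: Int_def)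
    have finK: "findim ?K" by (rule findim_mono[OF M _ subK]) auto
    have "?K \<noteq> {0}" using v by (auto simp: shift_def)
    then have K0: "dim ?K \<noteq> 0" using findim_dim_0[OF finK] by simp
    have "?I l = {0}"
    proof (rule ccontr)
      assume I0: "?I l \<noteq> {0}"
      have lt: "dim (?I l) < dim M" using rn K0 by simp
      have "\<exists>m. \<forall>x\<in>?I l. c x = m *s x"
      proof (rule less.hyps[OF lt findim_image[OF sh M] perfI])
        show "\<tau> i x \<in> ?I l" if "i < p" "x \<in> ?I l" for i x
          using submoduleD(3)[OF subI that] .
        show "c x \<in> ?I l" if xI: "x \<in> ?I l" for x
        proof -
          obtain y where y: "y \<in> M" "x = shift l y" using xI by auto
          have "c x = shift l (c y)"
            unfolding y(2) by (simp add: shift_def endo.linear_diff[OF c] endo.linear_scale[OF c])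
          then show ?thesis using cM[OF y(1)] by simp
        qed
        show "c (\<tau> i x) = \<tau> i (c x)" if "i < p" "x \<in> ?I l" for i x
          using comm[OF that(1)] that(2) submoduleD(2)[OF subI] by blast
        show "s \<le> dim Y" if "submodule p \<tau> (?I l) Y" "perfect p \<tau> Y" "Y \<noteq> {0}" for Y
          using big[OF submodule_trans[OF subI that(1)] that(2,3)] .
        show "dim (?I l) < 2 * s" using lt small by simp
      qed
      then obtain m where m: "\<And>x. x \<in> M \<Longrightarrow> shift m (shift l x) = 0"
        unfolding shift_def by auto
      have "?I m \<subseteq> ?K"
        using m shM shsh by auto
      moreover have "?I m \<noteq> {0}"
      proof (cases "m = l")
        case True
        then show ?thesis using I0 by simp
      next
        case False
        have "shift m v = (l - m) *s v" using v by (simp add: shift_def scale_left_diff_distrib)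
        then have "shift m v \<noteq> 0" using False v by simp
        then show ?thesis using v(1) by auto
      qed
      ultimately have "s \<le> dim ?K"
        using bigI[of m] dim_subspace_mono[OF finK submoduleD(1)[OF subI]] by fastforce
      then show False using bigI[OF I0] rn small by simp
    qed
    then have "\<forall>x\<in>M. shift l x = 0" by auto
    then show ?thesis unfolding shift_def by auto
  qed
qed

end

section \<open>Braid modules and conjugation by \<open>\<delta>\<close>\<close>

locale braid_module = complex_vector_space scale
  for scale :: "complex \<Rightarrow> 'b::ab_group_add \<Rightarrow> 'b" (infixr \<open>*s\<close> 75) +
  fixes q :: nat and \<sigma> :: "nat \<Rightarrow> 'b \<Rightarrow> 'b" and V :: "'b set"
  assumes lin: "\<And>i. endomorphism (\<sigma> i)"
    and findim_V: "findim V"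
    and stable: "\<And>i x. i < q \<Longrightarrow> x \<in> V \<Longrightarrow> \<sigma> i x \<in> V"
    and inj: "\<And>i x. i < q \<Longrightarrow> x \<in> V \<Longrightarrow> \<sigma> i x = 0 \<Longrightarrow> x = 0"
    and far: "\<And>i j x. j < q \<Longrightarrow> i + 2 \<le> j \<Longrightarrow> x \<in> V \<Longrightarrow> \<sigma> i (\<sigma> j x) = \<sigma> j (\<sigma> i x)"
    and braid: "\<And>i x. Suc i < q \<Longrightarrow> x \<in> V \<Longrightarrow>
      \<sigma> i (\<sigma> (Suc i) (\<sigma> i x)) = \<sigma> (Suc i) (\<sigma> i (\<sigma> (Suc i) x))"
begin

lemmas lin_simps = endo.linear_0[OF lin] endo.linear_add[OF lin] endo.linear_diff[OF lin]
  endo.linear_scale[OF lin]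

lemma subspace_V: "subspace V"
  using findim_subspace[OF findim_V] .

lemma submodule_V: "submodule q \<sigma> V V"
  using subspace_V stable by (simp add: submodule_def)

lemma submodule_zero: "submodule q \<sigma> V {0}"
  using subspace_0[OF subspace_V] by (simp add: submodule_def lin_simps)

lemma findim_submodule: "submodule q \<sigma> V W \<Longrightarrow> findim W"
  using findim_mono[OF findim_V] submoduleD by metis

lemma braid_module_submodule:
  assumes W: "submodule q \<sigma> V W"
  shows "braid_module (*s) q \<sigma> W"
proof (intro braid_module.intro braid_module_axioms.intro complex_vector_space_axioms)
  show "findim W" using findim_submodule[OF W] .
  show "\<sigma> i (\<sigma> j x) = \<sigma> j (\<sigma> i x)" if "j < q" "i + 2 \<le> j" "x \<in> W" for i j x
    using far[OF that(1,2)] that(3) submoduleD(2)[OF W] by blast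
qed (use submoduleD[OF W] lin inj braid in auto)

text \<open>Restriction to the subgroup generated by
  \<open>\<sigma> 2, ..., \<sigma> (q - 1)\<close>, which commutes with \<open>\<sigma> 0\<close>.
  This is the source of the induction in steps of two.\<close>

lemma braid_module_shift: "braid_module (*s) (q - 2) (\<lambda>i. \<sigma> (i + 2)) V"
proof (intro braid_module.intro braid_module_axioms.intro complex_vector_space_axioms)
  show "\<sigma> (i + 2) x = 0 \<Longrightarrow> x = 0" if "i < q - 2" "x \<in> V" for i x
    using inj[of "i + 2"] that by simp
  show "\<sigma> (i + 2) (\<sigma> (j + 2) x) = \<sigma> (j + 2) (\<sigma> (i + 2) x)"
    if "j < q - 2" "i + 2 \<le> j" "x \<in> V" for i j x
    using far[of "j + 2" "i + 2"] that by simp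
  show "\<sigma> (i + 2) (\<sigma> (Suc i + 2) (\<sigma> (i + 2) x)) = \<sigma> (Suc i + 2) (\<sigma> (i + 2) (\<sigma> (Suc i + 2) x))"
    if "Suc i < q - 2" "x \<in> V" for i x
    using braid[of "i + 2"] that by simp
qed (use lin findim_V stable in auto)

text \<open>With the rightmost factor acting first, \<open>seg k\<close> is the product of
  \<open>\<sigma> 0, ..., \<sigma> (k - 1)\<close> and \<open>seg1 k\<close> that of
  \<open>\<sigma> 1, ..., \<sigma> k\<close>.\<close>

primrec seg :: "nat \<Rightarrow> 'b \<Rightarrow> 'b" where
  "seg 0 x = x"
| "seg (Suc k) x = seg k (\<sigma> k x)"

primrec seg1 :: "nat \<Rightarrow> 'b \<Rightarrow> 'b" where
  "seg1 0 x = x"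
| "seg1 (Suc k) x = seg1 k (\<sigma> (Suc k) x)"

abbreviation \<delta> :: "'b \<Rightarrow> 'b" where "\<delta> \<equiv> seg q"

lemma seg_stable: "k \<le> q \<Longrightarrow> x \<in> V \<Longrightarrow> seg k x \<in> V"
  by (induction k arbitrary: x) (auto simp: stable)

lemma seg_inj: "k \<le> q \<Longrightarrow> x \<in> V \<Longrightarrow> seg k x = 0 \<Longrightarrow> x = 0"
proof (induction k arbitrary: x)
  case (Suc k)
  then have "\<sigma> k x = 0" using stable[of k x] by simp
  then show ?case using inj[of k x] Suc by simp
qed simp

lemma endomorphism_seg: "endomorphism (seg k)"
proof (induction k)
  case 0
  then show ?case using linear_ident by (simp add: fun_eq_iff cong: if_cong)
next
  case (Suc k)
  then show ?case using Vector_Spaces.linear_compose[OF lin Suc, of k] by (simp add: o_def)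
qed

lemmas seg_simps = endo.linear_0[OF endomorphism_seg] endo.linear_add[OF endomorphism_seg]
  endo.linear_diff[OF endomorphism_seg] endo.linear_scale[OF endomorphism_seg]

lemma seg_far: "k < j \<Longrightarrow> j < q \<Longrightarrow> x \<in> V \<Longrightarrow> seg k (\<sigma> j x) = \<sigma> j (seg k x)"
proof (induction k arbitrary: x)
  case (Suc k)
  have "\<sigma> k (\<sigma> j x) = \<sigma> j (\<sigma> k x)" using Suc.prems by (intro far) auto
  then show ?case using Suc stable[of k x] by simp
qed simp

text \<open>Moving left through the product, \<open>\<sigma> i\<close> commutes with the factors
  above index \<open>i + 1\<close>, becomes \<open>\<sigma> (i + 1)\<close> in a braid relation with
  the factors \<open>i\<close> and \<open>i + 1\<close>, and then commutes with the factors below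
  \<open>i\<close>.\<close>

lemma seg_shift: "Suc i < k \<Longrightarrow> k \<le> q \<Longrightarrow> x \<in> V \<Longrightarrow> seg k (\<sigma> i x) = \<sigma> (Suc i) (seg k x)"
proof (induction k arbitrary: x)
  case (Suc k)
  show ?case
  proof (cases "Suc i = k")
    case True
    have "seg (Suc k) (\<sigma> i x) = seg i (\<sigma> i (\<sigma> (Suc i) (\<sigma> i x)))" using True[symmetric] by simp
    also have "\<dots> = seg i (\<sigma> (Suc i) (\<sigma> i (\<sigma> (Suc i) x)))"
      using braid[of i x] Suc.prems True by simp
    also have "\<dots> = \<sigma> (Suc i) (seg i (\<sigma> i (\<sigma> (Suc i) x)))"
      using Suc.prems True by (intro seg_far) (auto intro!: stable)
    finally show ?thesis using True[symmetric] by simp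
  next
    case False
    then have "\<sigma> k (\<sigma> i x) = \<sigma> i (\<sigma> k x)" using far[of k i x] Suc.prems by simp
    then show ?thesis using Suc False stable[of k x] by simp
  qed
qed simp

lemma \<delta>_shift: "Suc i < q \<Longrightarrow> x \<in> V \<Longrightarrow> \<delta> (\<sigma> i x) = \<sigma> (Suc i) (\<delta> x)"
  using seg_shift[of i q x] by simp

lemma \<delta>_seg: "k < q \<Longrightarrow> x \<in> V \<Longrightarrow> \<delta> (seg k x) = seg1 k (\<delta> x)"
proof (induction k arbitrary: x)
  case (Suc k)
  then show ?case using stable[of k x] \<delta>_shift[of k x] by simp
qed simp

lemma first_seg1: "\<sigma> 0 (seg1 k x) = seg (Suc k) x"
  by (induction k arbitrary: x) simp_all

text \<open>One conjugation by \<open>\<delta>\<close> generally takes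
  \<open>\<sigma> (q - 1)\<close> out of the list of generators; the second brings it to
  \<open>\<sigma> 0\<close>. The proof moves one \<open>\<delta>\<close> past all but the last
  factor of the other and completes the resulting \<open>seg1 (q - 1)\<close> to
  \<open>\<delta>\<close> by \<open>\<sigma> 0\<close> on the left.\<close>

lemma \<delta>_wrap:
  assumes "0 < q" "x \<in> V"
  shows "\<sigma> 0 (\<delta> (\<delta> x)) = \<delta> (\<delta> (\<sigma> (q - 1) x))"
proof -
  obtain p where p: "q = Suc p" using assms(1) gr0_implies_Suc by blast
  have "\<delta> (\<delta> x) = \<delta> (seg p (\<sigma> p x))" by (simp add: p)
  also have "\<dots> = seg1 p (\<delta> (\<sigma> p x))"
    using \<delta>_seg[of p "\<sigma> p x"] stable[of p x] assms p by simp
  finally show ?thesis using first_seg1[of p] p by simp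
qed

lemma \<delta>_submodule:
  assumes W: "submodule q \<sigma> V W"
  shows "\<delta> ` W = W"
proof (rule endomorphism_surj_on[OF endomorphism_seg findim_submodule[OF W]])
  interpret W: braid_module "(*s)" q \<sigma> W by (rule braid_module_submodule[OF W])
  show "\<delta> x \<in> W" if "x \<in> W" for x using W.seg_stable[OF order_refl that] .
  show "x = 0" if "x \<in> W" "\<delta> x = 0" for x
    using seg_inj[OF order_refl _ that(2)] that(1) submoduleD(2)[OF W] by auto
qed

lemma \<delta>_surj:
  assumes "y \<in> V" obtains x where "x \<in> V" "y = \<delta> x"
  using \<delta>_submodule[OF submodule_V] assms by blast

lemma \<delta>_reflects_submodule:
  assumes W: "submodule q \<sigma> V W" and "x \<in> V" "\<delta> x \<in> W"
  shows "x \<in> W"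
proof -
  obtain y where y: "y \<in> W" "\<delta> x = \<delta> y" using \<delta>_submodule[OF W] assms(3) by (metis imageE)
  then have "\<delta> (x - y) = 0" by (simp add: seg_simps)
  moreover have "x - y \<in> V" using y assms submoduleD(2)[OF W] subspace_diff[OF subspace_V] by blast
  ultimately have "x - y = 0" using seg_inj[OF order_refl, of "x - y"] by simp
  then show ?thesis using y by simp
qed

lemma generator_submodule:
  assumes W: "submodule q \<sigma> V W" and i: "i < q"
  shows "\<sigma> i ` W = W"
  using submoduleD[OF W] i inj
  by (intro endomorphism_surj_on[OF lin findim_submodule[OF W]]) auto

lemma generator_reflects_submodule:
  assumes W: "submodule q \<sigma> V W" and i: "i < q" and "x \<in> V" "\<sigma> i x \<in> W"
  shows "x \<in> W"
proof -
  obtain y where y: "y \<in> W" "\<sigma> i x = \<sigma> i y" using generator_submodule[OF W i] assms(4) by (metis imageE)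
  then have "\<sigma> i (x - y) = 0" by (simp add: lin_simps)
  moreover have "x - y \<in> V" using y assms submoduleD(2)[OF W] subspace_diff[OF subspace_V] by blast
  ultimately have "x - y = 0" using inj[OF i, of "x - y"] by simp
  then show ?thesis using y by simp
qed

text \<open>One pair of neighbours suffices: conjugation by \<open>\<delta>\<close> and its inverse
  reaches every other pair of neighbours, and the remaining differences telescope.\<close>

lemma absorbs_differencesI:
  assumes W: "submodule q \<sigma> V W" and i: "Suc i < q"
    and D: "\<And>x. x \<in> V \<Longrightarrow> \<sigma> i x - \<sigma> (Suc i) x \<in> W"
  shows "absorbs_differences q \<sigma> V W"
proof -
  note sub = submoduleD(1)[OF W]
  let ?P = "\<lambda>j. \<forall>x\<in>V. \<sigma> j x - \<sigma> (Suc j) x \<in> W"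
  have up: "?P (Suc j)" if "?P j" "Suc (Suc j) < q" for j
  proof
    fix y assume "y \<in> V"
    then obtain x where x: "x \<in> V" "y = \<delta> x" using \<delta>_surj by metis
    have "\<sigma> (Suc j) y - \<sigma> (Suc (Suc j)) y = \<delta> (\<sigma> j x - \<sigma> (Suc j) x)"
      using x that(2) by (simp add: \<delta>_shift seg_simps)
    also have "\<dots> \<in> W" using that(1) x(1) \<delta>_submodule[OF W] by blast
    finally show "\<sigma> (Suc j) y - \<sigma> (Suc (Suc j)) y \<in> W" .
  qed
  have down: "?P j" if "?P (Suc j)" "Suc (Suc j) < q" for j
  proof
    fix x assume x: "x \<in> V"
    have "\<delta> (\<sigma> j x - \<sigma> (Suc j) x) = \<sigma> (Suc j) (\<delta> x) - \<sigma> (Suc (Suc j)) (\<delta> x)"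
      using x that(2) by (simp add: \<delta>_shift seg_simps)
    then have "\<delta> (\<sigma> j x - \<sigma> (Suc j) x) \<in> W" using that(1) seg_stable[OF order_refl x] by simp
    then show "\<sigma> j x - \<sigma> (Suc j) x \<in> W"
      using \<delta>_reflects_submodule[OF W subspace_diff[OF subspace_V stable stable]] x that(2) by simp
  qed
  \<comment> \<open>Descent from \<open>i\<close> to 0; truncated subtraction keeps the index at 0
    once it is reached.\<close>
  have P0: "?P (i - k)" for k
  proof (induction k)
    case 0
    then show ?case using D by simp
  next
    case (Suc k)
    show ?case
    proof (cases "i \<le> k")
      case False
      then have "i - k = Suc (i - Suc k)" by simp
      then show ?thesis using Suc down[of "i - Suc k"] i False by simp
    qed (use Suc in simp)
  qed
  have P: "?P j" if "Suc j < q" for j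
    using that
  proof (induction j)
    case 0
    then show ?case using P0[of i] by simp
  qed (use up in auto)
  have D0: "\<sigma> 0 x - \<sigma> j x \<in> W" if "j < q" "x \<in> V" for j x
    using that(1)
  proof (induction j)
    case 0
    then show ?case using subspace_0[OF sub] by simp
  next
    case (Suc j)
    have "\<sigma> 0 x - \<sigma> (Suc j) x = (\<sigma> 0 x - \<sigma> j x) + (\<sigma> j x - \<sigma> (Suc j) x)" by simp
    then show ?case using subspace_add[OF sub] Suc P that(2) by (metis Suc_lessD)
  qed
  have "\<sigma> j x - \<sigma> k x \<in> W" if "j < q" "k < q" "x \<in> V" for j k x
  proof -
    have "\<sigma> j x - \<sigma> k x = (\<sigma> 0 x - \<sigma> k x) - (\<sigma> 0 x - \<sigma> j x)" by simp
    then show ?thesis using subspace_diff[OF sub D0[OF that(2,3)] D0[OF that(1,3)]] by simp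
  qed
  then show ?thesis by (simp add: absorbs_differences_def)
qed

text \<open>The ideal generated by the differences of generators is idempotent: modulo its square the
  commutators with \<open>\<sigma> 0\<close> vanish, after which the braid relation forces \<open>\<sigma> 1 = \<sigma> 0\<close>.\<close>

lemma absorbs_differences_trans:
  assumes q: "4 \<le> q" and Y: "submodule q \<sigma> V Y" and YD: "absorbs_differences q \<sigma> V Y"
    and Z: "submodule q \<sigma> V Z" and ZD: "absorbs_differences q \<sigma> Y Z"
  shows "absorbs_differences q \<sigma> V Z"
proof (rule absorbs_differencesI[OF Z, of 0])
  note sub = submoduleD(1)[OF Z]
  have d: "\<sigma> j (\<sigma> i v - \<sigma> 0 v) - \<sigma> 0 (\<sigma> i v - \<sigma> 0 v) \<in> Z" if "i < q" "j < q" "v \<in> V" for i j v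
    using absorbs_differencesD[OF ZD that(2)] absorbs_differencesD[OF YD that(1)] that(3) q by simp
  have c: "\<sigma> 1 (\<sigma> 0 v) - \<sigma> 0 (\<sigma> 1 v) \<in> Z" if v: "v \<in> V" for v
  proof -
    \<comment> \<open>Since \<open>\<sigma> 3\<close> commutes with \<open>\<sigma> 0\<close> and
      \<open>\<sigma> 1\<close>, the commutator of \<open>\<sigma> 1\<close> and
      \<open>\<sigma> 0\<close> equals that of the differences
      \<open>\<sigma> 3 - \<sigma> 0\<close> and \<open>\<sigma> 1 - \<sigma> 0\<close>, a
      combination of products of two differences.\<close>
    have "\<sigma> 1 (\<sigma> 3 v) = \<sigma> 3 (\<sigma> 1 v)" "\<sigma> 0 (\<sigma> 3 v) = \<sigma> 3 (\<sigma> 0 v)"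
      using far[of 3 1 v] far[of 3 0 v] v q by simp_all
    then have "\<sigma> 1 (\<sigma> 0 v) - \<sigma> 0 (\<sigma> 1 v) =
        (\<sigma> 3 (\<sigma> 1 v - \<sigma> 0 v) - \<sigma> 0 (\<sigma> 1 v - \<sigma> 0 v)) - (\<sigma> 1 (\<sigma> 3 v - \<sigma> 0 v) - \<sigma> 0 (\<sigma> 3 v - \<sigma> 0 v))"
      by (simp add: lin_simps algebra_simps)
    then show ?thesis using subspace_diff[OF sub d[of 1 3 v] d[of 3 1 v]] q v by simp
  qed
  fix v assume v: "v \<in> V"
  have e: "\<sigma> 1 v - \<sigma> 0 v \<in> Y" using absorbs_differencesD[OF YD, of 1 0 v] v q by simp
  have "\<sigma> 0 (\<sigma> 1 v - \<sigma> 0 v) \<in> Y" using submoduleD(3)[OF Y _ e, of 0] q by simp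
  then have z1: "\<sigma> 1 (\<sigma> 0 (\<sigma> 1 v - \<sigma> 0 v)) - \<sigma> 0 (\<sigma> 0 (\<sigma> 1 v - \<sigma> 0 v)) \<in> Z"
    using absorbs_differencesD[OF ZD, of 1 0] q by simp
  have z2: "\<sigma> 1 (\<sigma> 0 (\<sigma> 0 v)) - \<sigma> 0 (\<sigma> 1 (\<sigma> 0 v)) \<in> Z"
    using c[OF stable[OF _ v, of 0]] q by simp
  have "\<sigma> 0 (\<sigma> 1 (\<sigma> 0 v)) = \<sigma> 1 (\<sigma> 0 (\<sigma> 1 v))" using braid[of 0 v] q v by simp
  \<comment> \<open>Both summands on the right lie in \<open>Z\<close>, by \<open>z1\<close> and
    \<open>z2\<close>; afterwards the invertible \<open>\<sigma> 0\<close> is cancelled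
    twice.\<close>
  then have "\<sigma> 0 (\<sigma> 0 (\<sigma> 0 v - \<sigma> 1 v)) =
     (\<sigma> 1 (\<sigma> 0 (\<sigma> 1 v - \<sigma> 0 v)) - \<sigma> 0 (\<sigma> 0 (\<sigma> 1 v - \<sigma> 0 v))) + (\<sigma> 1 (\<sigma> 0 (\<sigma> 0 v)) - \<sigma> 0 (\<sigma> 1 (\<sigma> 0 v)))"
    by (simp add: lin_simps algebra_simps)
  then have zz: "\<sigma> 0 (\<sigma> 0 (\<sigma> 0 v - \<sigma> 1 v)) \<in> Z" using subspace_add[OF sub z1 z2] by simp
  have "\<sigma> 0 v - \<sigma> 1 v \<in> V" using subspace_diff[OF subspace_V stable[OF _ v] stable[OF _ v]] q by simp
  then have "\<sigma> 0 v - \<sigma> 1 v \<in> Z"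
    using generator_reflects_submodule[OF Z, of 0] zz q stable[of 0] by simp
  then show "\<sigma> 0 v - \<sigma> (Suc 0) v \<in> Z" by simp
qed (use q in simp)

lemmas submodule_core_V = submodule_core[OF submodule_V]

text \<open>Idempotence of \<open>J\<close> in module form: a submodule containing
  \<open>J J V\<close> contains \<open>J V\<close>.\<close>

lemma perfect_core:
  assumes "4 \<le> q"
  shows "perfect q \<sigma> (core q \<sigma> V)"
  unfolding perfect_def
proof (intro allI impI)
  fix W assume W: "submodule q \<sigma> (core q \<sigma> V) W" and D: "absorbs_differences q \<sigma> (core q \<sigma> V) W"
  have "submodule q \<sigma> V W" by (rule submodule_trans[OF submodule_core_V(1) W])
  moreover from this have "absorbs_differences q \<sigma> V W"
    by (rule absorbs_differences_trans[OF assms submodule_core_V _ D])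
  ultimately show "W = core q \<sigma> V"
    using core_least submoduleD(2)[OF W] by blast
qed

text \<open>Under these assumptions the zero submodule absorbs all differences. Later contradictions
  arise by producing two equal neighbours.\<close>

lemma perfect_zeroI:
  assumes "perfect q \<sigma> V" "Suc i < q" "\<And>x. x \<in> V \<Longrightarrow> \<sigma> i x = \<sigma> (Suc i) x"
  shows "V = {0}"
  using perfectD[OF assms(1) submodule_zero absorbs_differencesI[OF submodule_zero assms(2)]]
    assms(3) by simp

end

section \<open>Low-dimensional perfect modules and orthogonality\<close>

context complex_vector_space
begin

text \<open>Compare the eigenvalues of \<open>v\<close>, \<open>w\<close> and \<open>v + w\<close>:
  either they agree, or \<open>w\<close> is a multiple of \<open>v\<close>.\<close>

lemma scalar_if_all_eigenvectors:
  assumes f: "endomorphism f" and V: "subspace V"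
    and ev: "\<And>v. v \<in> V \<Longrightarrow> \<exists>l. f v = l *s v"
  shows "\<exists>l. \<forall>v\<in>V. f v = l *s v"
proof (cases "V \<subseteq> {0}")
  case True
  then show ?thesis by (intro exI[of _ 0]) (auto simp: endo.linear_0[OF f])
next
  case False
  then obtain v where v: "v \<in> V" "v \<noteq> 0" by auto
  obtain l where l: "f v = l *s v" using ev[OF v(1)] by blast
  have "f w = l *s w" if w: "w \<in> V" for w
  proof -
    obtain m where m: "f w = m *s w" using ev[OF w] by blast
    obtain k where k: "f (v + w) = k *s (v + w)" using ev[OF subspace_add[OF V v(1) w]] by blast
    then have eq: "(l - k) *s v = (k - m) *s w"
      by (simp add: endo.linear_add[OF f] l m algebra_simps)
    show ?thesis
    proof (cases "k = m")
      case True
      then show ?thesis using eq v m by simp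
    next
      case False
      have "w = inverse (k - m) *s ((k - m) *s w)" using False by simp
      also have "\<dots> = (inverse (k - m) * (l - k)) *s v" unfolding eq[symmetric] by simp
      finally have "w = (inverse (k - m) * (l - k)) *s v" .
      then show ?thesis using l by (metis endo.linear_scale[OF f] scale_left_commute)
    qed
  qed
  then show ?thesis by blast
qed

lemma dim_Int_ge:
  assumes C: "findim C" and A: "subspace A" "A \<subseteq> C" and B: "subspace B" "B \<subseteq> C"
  shows "dim A + dim B \<le> dim C + dim (A \<inter> B)"
proof -
  have "span (A \<union> B) \<subseteq> C" using span_minimal[of "A \<union> B" C] A B findim_subspace[OF C] by simp
  then have "dim (span (A \<union> B)) \<le> dim C" by (rule dim_subspace_mono[OF C subspace_span])
  then show ?thesis
    using dim_span_Un_Int[OF findim_mono[OF C A(2,1)] findim_mono[OF C B(2,1)]] by simp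
qed

end

context braid_module
begin

text \<open>Start of the induction on dimensions. In dimension at most 2, either
  \<open>\<sigma> 0\<close> is a scalar and equals its conjugate \<open>\<sigma> 1\<close>, or it
  has a cyclic vector and everything commuting with it is a polynomial in it; then
  \<open>\<sigma> 2\<close> and \<open>\<sigma> 3\<close> commute and hence coincide.\<close>

lemma dim_perfect_ge_3:
  assumes q: "4 \<le> q" and perf: "perfect q \<sigma> V" and V0: "V \<noteq> {0}"
  shows "3 \<le> dim V"
proof (rule ccontr)
  assume "\<not> 3 \<le> dim V"
  then have small: "dim V \<le> 2" by simp
  show False
  proof (cases "\<exists>l. \<forall>v\<in>V. \<sigma> 0 v = l *s v")
    case True
    then obtain l where l: "\<And>v. v \<in> V \<Longrightarrow> \<sigma> 0 v = l *s v" by blast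
    have "\<sigma> 0 y = \<sigma> (Suc 0) y" if y: "y \<in> V" for y
    proof -
      obtain x where x: "x \<in> V" "y = \<delta> x" using \<delta>_surj[OF y] .
      have "\<sigma> (Suc 0) y = \<delta> (\<sigma> 0 x)" using \<delta>_shift[of 0 x] q x by simp
      then show ?thesis using l[OF x(1)] l[OF y] x(2) by (simp add: seg_simps)
    qed
    then show False using perfect_zeroI[OF perf, of 0] V0 q by simp
  next
    case False
    then obtain v where v: "v \<in> V" "\<And>l. \<sigma> 0 v \<noteq> l *s v"
      using scalar_if_all_eigenvectors[OF lin subspace_V] by metis
    let ?B = "{\<sigma> 0 v, v}"
    have v0: "v \<noteq> 0" using v(2)[of 0] by (auto simp: lin_simps)
    have s0: "\<sigma> 0 v \<in> V" using stable[OF _ v(1), of 0] q by simp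
    have "\<sigma> 0 v \<notin> span {v}" using v(2) by (auto simp: span_singleton)
    then have "independent ?B" using independent_insertI[of "\<sigma> 0 v" "{v}"] v0 by simp
    moreover have "\<sigma> 0 v \<noteq> v" using v(2)[of 1] by simp
    ultimately have "dim (span ?B) = 2" using dim_span_eq_card_independent by simp
    moreover have "span ?B \<subseteq> V" using span_minimal[OF _ subspace_V] v(1) s0 by simp
    ultimately have V: "span ?B = V"
      using findim_subspace_eqI[OF findim_V subspace_span] small by simp
    have ex: "\<exists>a b. x = a *s v + b *s \<sigma> 0 v" if x: "x \<in> V" for x
    proof -
      have "x \<in> span ?B" using x V by simp
      then obtain b where "x - b *s \<sigma> 0 v \<in> span {v}" using span_breakdown_eq by metis
      then obtain a where "x - b *s \<sigma> 0 v = a *s v" by (auto simp: span_singleton)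
      then have "x = a *s v + b *s \<sigma> 0 v" by (simp add: algebra_simps)
      then show ?thesis by blast
    qed
    \<comment> \<open>An operator commuting with \<open>\<sigma> 0\<close> is determined by its
      value at the cyclic vector \<open>v\<close>.\<close>
    have poly: "\<exists>a b. \<forall>x\<in>V. \<sigma> j x = a *s x + b *s \<sigma> 0 x" if j: "2 \<le> j" "j < q" for j
    proof -
      obtain a b where ab: "\<sigma> j v = a *s v + b *s \<sigma> 0 v" using ex[OF stable[OF j(2) v(1)]] by blast
      have "\<sigma> j x = a *s x + b *s \<sigma> 0 x" if x: "x \<in> V" for x
      proof -
        obtain d e where de: "x = d *s v + e *s \<sigma> 0 v" using ex[OF x] by blast
        have "\<sigma> j (\<sigma> 0 v) = \<sigma> 0 (\<sigma> j v)" using far[of j 0 v] j v(1) by simp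
        then show ?thesis unfolding de
          by (simp add: lin_simps ab algebra_simps)
      qed
      then show ?thesis by blast
    qed
    obtain a b where ab: "\<And>x. x \<in> V \<Longrightarrow> \<sigma> 3 x = a *s x + b *s \<sigma> 0 x" using poly[of 3] q by auto
    have comm: "\<sigma> 2 (\<sigma> 3 x) = \<sigma> 3 (\<sigma> 2 x)" if x: "x \<in> V" for x
    proof -
      have "\<sigma> 2 x \<in> V" "\<sigma> 0 (\<sigma> 2 x) = \<sigma> 2 (\<sigma> 0 x)" using stable[OF _ x] far[of 2 0 x] q x by simp_all
      then show ?thesis using ab[OF x] ab[of "\<sigma> 2 x"] by (simp add: lin_simps)
    qed
    \<comment> \<open>Commuting invertible operators that satisfy the braid relation are
      equal.\<close>
    have "\<sigma> 2 y = \<sigma> (Suc 2) y" if y: "y \<in> V" for y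
    proof -
      obtain x where x: "x \<in> V" "y = \<sigma> 3 x"
        using generator_submodule[OF submodule_V, of 3] q y by auto
      have "\<sigma> 2 (\<sigma> 3 (\<sigma> 2 x)) = \<sigma> 3 (\<sigma> 2 (\<sigma> 3 x))" using braid[of 2 x] q x(1) by simp
      moreover have "\<sigma> 2 (\<sigma> 3 (\<sigma> 2 x)) = \<sigma> 2 (\<sigma> 2 y)" using comm[OF x(1)] x(2) by simp
      moreover have "\<sigma> 3 (\<sigma> 2 (\<sigma> 3 x)) = \<sigma> 2 (\<sigma> 3 y)" using comm[OF y] x(2) by simp
      ultimately have "\<sigma> 2 (\<sigma> 2 y - \<sigma> 3 y) = 0" by (simp add: lin_simps)
      moreover have "\<sigma> 2 y - \<sigma> 3 y \<in> V" using subspace_diff[OF subspace_V stable stable] q y by simp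
      ultimately have "\<sigma> 2 y - \<sigma> 3 y = 0" using inj[of 2 "\<sigma> 2 y - \<sigma> 3 y"] q by simp
      then show ?thesis by (simp add: numeral_3_eq_3 numeral_2_eq_2)
    qed
    then show False using perfect_zeroI[OF perf, of 2] V0 q by simp
  qed
qed

section \<open>Vanishing of the products of distant operators \<open>dev c i\<close>\<close>

definition dev :: "complex \<Rightarrow> nat \<Rightarrow> 'b \<Rightarrow> 'b" where
  "dev c i x = \<sigma> i x - c *s x"

lemma endomorphism_dev: "endomorphism (dev c i)"
  unfolding dev_def[abs_def] by (rule endomorphism_sub_scale[OF lin])

lemmas dev_simps = endo.linear_0[OF endomorphism_dev] endo.linear_add[OF endomorphism_dev]
  endo.linear_diff[OF endomorphism_dev] endo.linear_scale[OF endomorphism_dev]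

lemma dev_stable: "i < q \<Longrightarrow> x \<in> V \<Longrightarrow> dev c i x \<in> V"
  unfolding dev_def using subspace_diff[OF subspace_V stable subspace_scale[OF subspace_V]] by simp

lemma dev_generator:
  assumes "k < q" "i < q" "x \<in> V" "k + 2 \<le> i \<or> i + 2 \<le> k"
  shows "dev c k (\<sigma> i x) = \<sigma> i (dev c k x)"
proof -
  have "\<sigma> k (\<sigma> i x) = \<sigma> i (\<sigma> k x)" using far[of i k x] far[of k i x] assms by auto
  then show ?thesis by (simp add: dev_def lin_simps)
qed

lemma dev_far:
  assumes "k < q" "i < q" "x \<in> V" "k + 2 \<le> i \<or> i + 2 \<le> k"
  shows "dev c k (dev c i x) = dev c i (dev c k x)"
  using dev_generator[OF assms, of c] by (simp add: dev_def[of c i] dev_simps)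

lemma \<delta>_dev: "Suc i < q \<Longrightarrow> x \<in> V \<Longrightarrow> \<delta> (dev c i x) = dev c (Suc i) (\<delta> x)"
  by (simp add: dev_def seg_simps \<delta>_shift)

lemma dev_diff: "dev c i x - dev c j x = \<sigma> i x - \<sigma> j x"
  by (simp add: dev_def)

text \<open>Conjugating \<open>h\<close> by powers of \<open>\<delta>\<close> gives enough relations
  to identify all distant products with one operator \<open>T\<close>. It commutes with every
  generator, so its kernel is a submodule; the kernel absorbs differences and is therefore
  \<open>V\<close>.\<close>

lemma dev_dev_zero:
  assumes q: "6 \<le> q" and perf: "perfect q \<sigma> V"
    and h: "\<And>i j x. 2 \<le> i \<Longrightarrow> i < q \<Longrightarrow> 2 \<le> j \<Longrightarrow> j < q \<Longrightarrow> x \<in> V \<Longrightarrow>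
      dev c 0 (\<sigma> i x - \<sigma> j x) = 0"
    and ij: "i + 2 \<le> j" "j < q" and x: "x \<in> V"
  shows "dev c i (dev c j x) = 0"
proof -
  have F1: "dev c p (\<sigma> i x - \<sigma> j x) = 0"
    if "p + 2 \<le> i" "i < q" "p + 2 \<le> j" "j < q" "x \<in> V" for p i j x
    using that
  proof (induction p arbitrary: i j x)
    case 0
    then show ?case using h by simp
  next
    case (Suc p)
    obtain i' j' where i': "i = Suc i'" and j': "j = Suc j'"
      using Suc.prems by (metis Suc_le_D add_Suc)
    obtain y where y: "y \<in> V" "x = \<delta> y" using \<delta>_surj[OF Suc.prems(5)] .
    have "\<sigma> i' y - \<sigma> j' y \<in> V"
      using subspace_diff[OF subspace_V stable stable] y(1) Suc.prems i' j' by simp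
    then have "dev c (Suc p) (\<sigma> i x - \<sigma> j x) = \<delta> (dev c p (\<sigma> i' y - \<sigma> j' y))"
      using Suc.prems i' j' y by (simp add: \<delta>_dev \<delta>_shift seg_simps)
    also have "dev c p (\<sigma> i' y - \<sigma> j' y) = 0" using Suc i' j' y by simp
    finally show ?case by (simp add: seg_simps)
  qed
  have F1': "dev c p (dev c i x) = dev c p (dev c j x)"
    if "p + 2 \<le> i" "i < q" "p + 2 \<le> j" "j < q" "x \<in> V" for p i j x
    using F1[OF that] dev_diff[of c i x j] by (metis dev_simps(3) right_minus_eq)
  have F2: "dev c (p + 3) (\<sigma> p x - \<sigma> (Suc p) x) = 0" if "p + 3 < q" "x \<in> V" for p x
    using that
  proof (induction p arbitrary: x)
    case 0
    obtain x1 where x1: "x1 \<in> V" "x = \<delta> x1" using \<delta>_surj[OF 0(2)] .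
    obtain x2 where x2: "x2 \<in> V" "x1 = \<delta> x2" using \<delta>_surj[OF x1(1)] .
    obtain y where y: "y \<in> V" "x2 = \<delta> y" using \<delta>_surj[OF x2(1)] .
    have dV: "\<delta> z \<in> V" if "z \<in> V" for z using seg_stable[OF order_refl that] .
    \<comment> \<open>The cube of \<open>\<delta>\<close> conjugates \<open>\<sigma> 0\<close>,
      \<open>\<sigma> (q - 2)\<close>, \<open>\<sigma> (q - 1)\<close> to \<open>\<sigma> 3\<close>,
      \<open>\<sigma> 0\<close>, \<open>\<sigma> 1\<close>. So the case \<open>i = q - 2\<close>,
      \<open>j = q - 1\<close> of \<open>h\<close> becomes the claim for
      \<open>p = 0\<close>.\<close>
    have s1: "\<sigma> 0 (\<delta> (\<delta> (\<delta> y))) = \<delta> (\<delta> (\<delta> (\<sigma> (q - 2) y)))"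
    proof -
      have "\<delta> (\<sigma> (q - 2) y) = \<sigma> (q - 1) (\<delta> y)"
        using \<delta>_shift[of "q - 2" y] y(1) q by (simp add: numeral_2_eq_2 Suc_diff_Suc)
      then show ?thesis using \<delta>_wrap[of "\<delta> y"] dV[OF y(1)] q by simp
    qed
    have s2: "\<sigma> (Suc 0) (\<delta> (\<delta> (\<delta> y))) = \<delta> (\<delta> (\<delta> (\<sigma> (q - 1) y)))"
      using \<delta>_shift[of 0 "\<delta> (\<delta> y)"] \<delta>_wrap[of y] dV[OF dV[OF y(1)]] y(1) q by simp
    let ?z = "\<sigma> (q - 2) y - \<sigma> (q - 1) y"
    have zV: "?z \<in> V" using subspace_diff[OF subspace_V stable stable] y(1) q by simp
    have "dev c 3 (\<delta> (\<delta> (\<delta> ?z))) = \<delta> (\<delta> (\<delta> (dev c 0 ?z)))"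
      using \<delta>_dev[of 0 ?z c] \<delta>_dev[of 1 "\<delta> ?z" c] \<delta>_dev[of 2 "\<delta> (\<delta> ?z)" c] zV dV q
      by (simp add: numeral_3_eq_3 numeral_2_eq_2)
    also have "dev c 0 ?z = 0" using h y(1) q by simp
    finally show ?case using s1 s2 x1 x2 y by (simp add: seg_simps)
  next
    case (Suc p)
    obtain y where y: "y \<in> V" "x = \<delta> y" using \<delta>_surj[OF Suc.prems(2)] .
    have "\<sigma> p y - \<sigma> (Suc p) y \<in> V"
      using subspace_diff[OF subspace_V stable stable] y(1) Suc.prems by simp
    then have "dev c (Suc p + 3) (\<sigma> (Suc p) x - \<sigma> (Suc (Suc p)) x)
        = \<delta> (dev c (p + 3) (\<sigma> p y - \<sigma> (Suc p) y))"
      using Suc.prems y by (simp add: \<delta>_dev \<delta>_shift seg_simps)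
    also have "dev c (p + 3) (\<sigma> p y - \<sigma> (Suc p) y) = 0" using Suc y by simp
    finally show ?case by (simp add: seg_simps)
  qed
  have F2': "dev c (p + 3) (dev c p x) = dev c (p + 3) (dev c (Suc p) x)"
    if "p + 3 < q" "x \<in> V" for p x
    using F2[OF that] dev_diff[of c p x "Suc p"] by (metis dev_simps(3) right_minus_eq)
  define T where "T x = dev c 0 (dev c (q - 1) x)" for x
  \<comment> \<open>The left index drops from \<open>p + 1\<close> to \<open>p\<close> with
    \<open>p + 3\<close> as temporary right index: \<open>F1'\<close> exchanges the right index, and
    \<open>F2'\<close> the left one after the factors are commuted.\<close>
  have Tp: "dev c p (dev c (q - 1) x) = T x" if "p + 3 \<le> q" "x \<in> V" for p x
    using that
  proof (induction p)
    case 0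
    then show ?case by (simp add: T_def)
  next
    case (Suc p)
    have "dev c (Suc p) (dev c (q - 1) x) = dev c (Suc p) (dev c (p + 3) x)"
      using Suc.prems by (intro F1') auto
    also have "\<dots> = dev c (p + 3) (dev c (Suc p) x)"
      using Suc.prems by (intro dev_far) auto
    also have "\<dots> = dev c (p + 3) (dev c p x)"
      using Suc.prems F2' by simp
    also have "\<dots> = dev c p (dev c (p + 3) x)"
      using Suc.prems by (intro dev_far) auto
    also have "\<dots> = dev c p (dev c (q - 1) x)"
      using Suc.prems by (intro F1') auto
    finally show ?case using Suc by simp
  qed
  have Tij: "dev c i (dev c j x) = T x" if "i + 2 \<le> j" "j < q" "x \<in> V" for i j x
    using F1'[of i j "q - 1" x] Tp[of i x] that by simp
  have T: "endomorphism T"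
    using Vector_Spaces.linear_compose[OF endomorphism_dev[of c "q - 1"] endomorphism_dev[of c 0]]
    by (simp add: T_def[abs_def] o_def)
  have Tgen: "T (\<sigma> i x) = \<sigma> i (T x)" if i: "i < q" and x: "x \<in> V" for i x
  proof -
    \<comment> \<open>Any distant pair \<open>k\<close>, \<open>l\<close> represents
      \<open>T\<close>; choosing both indices distant from \<open>i\<close> makes \<open>T\<close>
      commute with \<open>\<sigma> i\<close>. The case \<open>i = 1\<close> uses the pair 3, 5,
      which requires six generators.\<close>
    have gen: "T (\<sigma> i x) = \<sigma> i (T x)" if kl: "k + 2 \<le> l" "l < q"
      "k + 2 \<le> i \<or> i + 2 \<le> k" "l + 2 \<le> i \<or> i + 2 \<le> l" for k l
      using dev_generator[of l i x c] dev_generator[of k i "dev c l x" c]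
        Tij[OF kl(1,2) x] Tij[OF kl(1,2) stable[OF i x]] kl i x dev_stable[of l x c] by simp
    consider "i = 0" | "i = 1" | "i = 2" | "i = 3" | "4 \<le> i" by linarith
    then show ?thesis
      by cases (use gen[of 2 4] gen[of 3 5] gen[of 0 4] gen[of 0 5] gen[of 0 2] q in auto)
  qed
  let ?Z = "{x \<in> V. T x = 0}"
  have "subspace ?Z"
    using subspace_inter[OF subspace_V endo.linear_subspace_kernel[OF T]] by (simp add: Int_def)
  then have Z: "submodule q \<sigma> V ?Z"
    by (auto simp: submodule_def stable Tgen lin_simps)
  \<comment> \<open>\<open>T\<close> is \<open>dev c 4\<close> after \<open>dev c 0\<close>, and
    \<open>dev c 0\<close> already kills the difference of \<open>\<sigma> 2\<close> and
    \<open>\<sigma> 3\<close>.\<close>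
  have "absorbs_differences q \<sigma> V ?Z"
  proof (rule absorbs_differencesI[OF Z, of 2])
    fix x assume x: "x \<in> V"
    have zV: "\<sigma> 2 x - \<sigma> 3 x \<in> V" using subspace_diff[OF subspace_V stable stable] x q by simp
    have "T (\<sigma> 2 x - \<sigma> 3 x) = dev c 4 (dev c 0 (\<sigma> 2 x - \<sigma> 3 x))"
      using Tij[of 0 4, OF _ _ zV] dev_far[of 0 4 _ c, OF _ _ zV] q by simp
    also have "dev c 0 (\<sigma> 2 x - \<sigma> 3 x) = 0" using h x q by simp
    finally show "\<sigma> 2 x - \<sigma> (Suc 2) x \<in> ?Z" using zV by (simp add: dev_simps numeral_3_eq_3 numeral_2_eq_2)
  qed (use q in simp)
  then have "?Z = V" using perfectD[OF perf Z] by simp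
  then show ?thesis using Tij[OF ij x] x by auto
qed

text \<open>The scalar \<open>c\<close> is the one by which \<open>\<sigma> 0\<close> acts on the
  core \<open>M\<close> of \<open>V\<close> for the subgroup of the generators from index 2 on. The
  bound on \<open>dim V\<close> is what \<open>centralizer_scalar\<close> needs, and
  \<open>c\<close> is nonzero because \<open>\<sigma> 0\<close> is injective on the nonzero
  \<open>M\<close>.\<close>

lemma ex_dev_dev_zero:
  assumes q: "6 \<le> q" and perf: "perfect q \<sigma> V" and V0: "V \<noteq> {0}"
    and big: "\<And>Y. submodule (q - 2) (\<lambda>i. \<sigma> (i + 2)) V Y \<Longrightarrow>
      perfect (q - 2) (\<lambda>i. \<sigma> (i + 2)) Y \<Longrightarrow> Y \<noteq> {0} \<Longrightarrow> s \<le> dim Y"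
    and small: "dim V < 2 * s"
  obtains c where "c \<noteq> 0"
    "\<And>i j x. i + 2 \<le> j \<Longrightarrow> j < q \<Longrightarrow> x \<in> V \<Longrightarrow> dev c i (dev c j x) = 0"
proof -
  let ?\<tau> = "\<lambda>i. \<sigma> (i + 2)"
  interpret S: braid_module "(*s)" "q - 2" ?\<tau> V by (rule braid_module_shift)
  define M where "M = core (q - 2) ?\<tau> V"
  have subM: "submodule (q - 2) ?\<tau> V M" and absM: "absorbs_differences (q - 2) ?\<tau> V M"
    unfolding M_def using S.submodule_core_V by auto
  have perfM: "perfect (q - 2) ?\<tau> M"
    unfolding M_def using S.perfect_core q by simp
  have MV: "M \<subseteq> V" using submoduleD(2)[OF subM] .
  note sM = submoduleD(1)[OF subM]
  have diffM: "\<sigma> i x - \<sigma> j x \<in> M" if "2 \<le> i" "i < q" "2 \<le> j" "j < q" "x \<in> V" for i j x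
  proof -
    have e: "i - 2 + 2 = i" "j - 2 + 2 = j" "i - 2 < q - 2" "j - 2 < q - 2" using that by auto
    show ?thesis using absorbs_differencesD[OF absM e(3,4) that(5)] unfolding e(1,2) .
  qed
  have M0: "M \<noteq> {0}"
  proof
    assume "M = {0}"
    then have "\<sigma> 2 x = \<sigma> (Suc 2) x" if "x \<in> V" for x
      using diffM[of 2 "Suc 2" x] that q by simp
    then show False using perfect_zeroI[OF perf, of 2] q V0 by simp
  qed
  have comm: "\<sigma> 0 (\<sigma> (i + 2) x) = \<sigma> (i + 2) (\<sigma> 0 x)" if "i < q - 2" "x \<in> V" for i x
    using far[of "i + 2" 0 x] that by simp
  \<comment> \<open>Minimality of the core shows that \<open>\<sigma> 0\<close> preserves
    \<open>M\<close>: as \<open>\<sigma> 0\<close> commutes with the shifted generators,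
    \<open>?W\<close> is again a submodule absorbing their differences, so it contains
    \<open>M\<close>.\<close>
  let ?W = "{x \<in> M. \<sigma> 0 x \<in> M}"
  have W: "submodule (q - 2) ?\<tau> V ?W"
    unfolding submodule_def
  proof (intro conjI allI impI ballI)
    show "subspace ?W"
      by (rule subspaceI)
        (auto simp: lin_simps subspace_0[OF sM] subspace_add[OF sM] subspace_scale[OF sM])
    show "\<sigma> (i + 2) x \<in> ?W" if i: "i < q - 2" and x: "x \<in> ?W" for i x
      using submoduleD(3)[OF subM i] comm[OF i] x MV by auto
  qed (use MV in auto)
  have "absorbs_differences (q - 2) ?\<tau> V ?W"
    unfolding absorbs_differences_def
  proof (intro allI impI ballI)
    fix i j x assume ij: "i < q - 2" "j < q - 2" "x \<in> V"
    have "\<sigma> 0 x \<in> V" using stable[OF _ ij(3), of 0] q by simp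
    then show "\<sigma> (i + 2) x - \<sigma> (j + 2) x \<in> ?W"
      using absorbs_differencesD[OF absM ij(1,2)] ij by (simp add: lin_simps comm del: add_2_eq_Suc')
  qed
  then have MW: "M \<subseteq> ?W" unfolding M_def[symmetric] using core_least[OF W] by (simp add: M_def)
  have "\<exists>l. \<forall>x\<in>M. \<sigma> 0 x = l *s x"
  proof (rule centralizer_scalar[where p = "q - 2" and \<tau> = ?\<tau> and s = s])
    show "findim M" using S.findim_submodule[OF subM] .
    show "\<sigma> (i + 2) x \<in> M" if "i < q - 2" "x \<in> M" for i x using submoduleD(3)[OF subM that] .
    show "\<sigma> 0 x \<in> M" if "x \<in> M" for x using MW that by auto
    show "\<sigma> 0 (\<sigma> (i + 2) x) = \<sigma> (i + 2) (\<sigma> 0 x)" if "i < q - 2" "x \<in> M" for i x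
      using comm[OF that(1)] that(2) MV by auto
    show "s \<le> dim Y" if "submodule (q - 2) ?\<tau> M Y" "perfect (q - 2) ?\<tau> Y" "Y \<noteq> {0}" for Y
      using big[OF submodule_trans[OF subM that(1)] that(2,3)] .
    show "dim M < 2 * s" using dim_subspace_mono[OF findim_V sM MV] small by simp
  qed (use lin perfM in auto)
  then obtain l where l: "\<And>x. x \<in> M \<Longrightarrow> \<sigma> 0 x = l *s x" by blast
  obtain x where x: "x \<in> M" "x \<noteq> 0" using M0 subspace_0[OF sM] by auto
  have "l \<noteq> 0" using l[OF x(1)] inj[of 0 x] x q MV by auto
  moreover have "dev l i (dev l j x) = 0" if "i + 2 \<le> j" "j < q" "x \<in> V" for i j x
  proof (rule dev_dev_zero[OF q perf _ that])
    show "dev l 0 (\<sigma> i x - \<sigma> j x) = 0" if "2 \<le> i" "i < q" "2 \<le> j" "j < q" "x \<in> V" for i j x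
      using l[OF diffM[OF that]] by (simp add: dev_def)
  qed
  ultimately show ?thesis by (rule that)
qed

end

section \<open>Dimension bounds for orthogonal braid modules\<close>

locale orthogonal_braid_module = braid_module scale q \<sigma> V
  for scale :: "complex \<Rightarrow> 'b::ab_group_add \<Rightarrow> 'b" (infixr \<open>*s\<close> 75) and q \<sigma> V +
  fixes c :: complex
  assumes c0: "c \<noteq> 0"
    and orth: "\<And>i j x. i + 2 \<le> j \<Longrightarrow> j < q \<Longrightarrow> x \<in> V \<Longrightarrow> dev c i (dev c j x) = 0"
begin

abbreviation a :: "nat \<Rightarrow> 'b \<Rightarrow> 'b" where "a \<equiv> dev c"

abbreviation U :: "nat \<Rightarrow> 'b set" where "U i \<equiv> a i ` V"

lemma orth': "i + 2 \<le> j \<Longrightarrow> j < q \<Longrightarrow> x \<in> V \<Longrightarrow> a j (a i x) = 0"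
  using dev_far[of j i x c] orth[of i j x] by simp

lemma generator_eq: "\<sigma> i x = a i x + c *s x"
  by (simp add: dev_def)

lemma findim_U: "i < q \<Longrightarrow> findim (U i)"
  using findim_image[OF endomorphism_dev findim_V] .

lemmas subspace_U = findim_subspace[OF findim_U]

lemma U_subset: "i < q \<Longrightarrow> U i \<subseteq> V"
  using dev_stable by auto

text \<open>Substitute \<open>a i + c\<close> for \<open>\<sigma> i\<close> in the braid relation
  and cancel the terms common to both sides.\<close>

lemma braid_dev:
  assumes "Suc i < q" "x \<in> V"
  shows "(c * c) *s a i x + c *s a i (a i x) + a i (a (Suc i) (a i x))
    = (c * c) *s a (Suc i) x + c *s a (Suc i) (a (Suc i) x) + a (Suc i) (a i (a (Suc i) x))"
  using braid[OF assms] by (simp add: dev_def lin_simps algebra_simps)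

text \<open>If the product \<open>a i a (i + 1)\<close> vanished, both cubic terms of
  \<open>braid_dev\<close> would drop out. Multiplying what is left by \<open>a i\<close> on the
  left, or by \<open>a (i + 1)\<close> on the right, and cancelling the invertible generator shows
  that both operators square to zero. Then \<open>a i = a (i + 1)\<close>, so two neighbouring
  generators agree.\<close>

lemma dev_dev_Suc_nonzero:
  assumes perf: "perfect q \<sigma> V" and V0: "V \<noteq> {0}" and i: "Suc i < q"
  shows "\<exists>x\<in>V. a i (a (Suc i) x) \<noteq> 0"
proof (rule ccontr)
  assume "\<not> (\<exists>x\<in>V. a i (a (Suc i) x) \<noteq> 0)"
  then have ab: "a i (a (Suc i) x) = 0" if "x \<in> V" for x using that by blast
  note st = dev_stable[OF i, of _ c] dev_stable[OF Suc_lessD[OF i], of _ c]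
  have rel: "(c * c) *s a i x + c *s a i (a i x) = (c * c) *s a (Suc i) x + c *s a (Suc i) (a (Suc i) x)"
    if x: "x \<in> V" for x
    using braid_dev[OF i x] ab[OF st(2)[OF x]] ab[OF x] by (simp add: dev_simps)
  have aa: "a i (a i y) = 0" if y: "y \<in> V" for y
  proof -
    obtain x where x: "x \<in> V" "y = \<sigma> i x"
      using generator_submodule[OF submodule_V Suc_lessD[OF i]] y by auto
    have "a i ((c * c) *s a i x + c *s a i (a i x)) = 0"
      unfolding rel[OF x(1)] using ab x(1) st by (simp add: dev_simps)
    moreover have "c *s a i (a i y) = a i ((c * c) *s a i x + c *s a i (a i x))"
      unfolding x(2) by (simp add: dev_def lin_simps algebra_simps)
    ultimately have "c *s a i (a i y) = 0" by (rule HOL.trans[rotated])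
    then show ?thesis using c0 by simp
  qed
  have bb: "a (Suc i) (a (Suc i) y) = 0" if y: "y \<in> V" for y
  proof -
    obtain x where x: "x \<in> V" "y = \<sigma> (Suc i) x"
      using generator_submodule[OF submodule_V i] y by auto
    have "(c * c) *s a (Suc i) (a (Suc i) x) + c *s a (Suc i) (a (Suc i) (a (Suc i) x)) = 0"
      using rel[OF st(1)[OF x(1)]] ab x(1) by (simp add: dev_simps)
    moreover have "c *s a (Suc i) (a (Suc i) y)
        = (c * c) *s a (Suc i) (a (Suc i) x) + c *s a (Suc i) (a (Suc i) (a (Suc i) x))"
      unfolding x(2) by (simp add: dev_def lin_simps algebra_simps)
    ultimately have "c *s a (Suc i) (a (Suc i) y) = 0" by (rule HOL.trans[rotated])
    then show ?thesis using c0 by simp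
  qed
  have "\<sigma> i x = \<sigma> (Suc i) x" if x: "x \<in> V" for x
  proof -
    have "a i x = a (Suc i) x" using rel[OF x] aa[OF x] bb[OF x] c0 by simp
    then show ?thesis by (simp add: dev_def)
  qed
  then show False using perfect_zeroI[OF perf i] V0 by simp
qed

definition tail :: "nat \<Rightarrow> 'b set" where
  "tail i = span (\<Union>j\<in>{i..<q}. U j)"

lemma subspace_tail: "subspace (tail i)"
  by (simp add: tail_def)

lemma tail_subset: "tail i \<subseteq> V"
  unfolding tail_def by (rule span_minimal[OF _ subspace_V]) (auto simp: dev_stable)

lemma findim_tail: "findim (tail i)"
  using findim_mono[OF findim_V tail_subset subspace_tail] .

lemma U_subset_tail: "i \<le> j \<Longrightarrow> j < q \<Longrightarrow> U j \<subseteq> tail i"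
  unfolding tail_def using span_superset by (rule order_trans[rotated]) auto

lemma tail_Suc_subset: "tail (Suc i) \<subseteq> tail i"
  unfolding tail_def by (intro span_mono UN_mono) auto

lemma tail_rec: "i < q \<Longrightarrow> tail i = span (U i \<union> tail (Suc i))"
proof (rule antisym)
  assume i: "i < q"
  have "(\<Union>j\<in>{i..<q}. U j) \<subseteq> span (U i \<union> tail (Suc i))"
  proof (intro UN_least)
    fix j assume j: "j \<in> {i..<q}"
    have "U j \<subseteq> U i \<union> tail (Suc i)"
      using j U_subset_tail[of "Suc i" j] by (cases "j = i") auto
    then show "U j \<subseteq> span (U i \<union> tail (Suc i))" using span_superset order_trans by metis
  qed
  then show "tail i \<subseteq> span (U i \<union> tail (Suc i))"
    unfolding tail_def[of i] by (rule span_minimal[OF _ subspace_span])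
  show "span (U i \<union> tail (Suc i)) \<subseteq> tail i"
    using U_subset_tail[OF order_refl i] tail_Suc_subset by (intro span_minimal subspace_tail) simp
qed

lemma tail_last: "0 < q \<Longrightarrow> tail (q - 1) = U (q - 1)"
proof -
  assume q: "0 < q"
  then have "{q - 1..<q} = {q - 1}" by auto
  then show ?thesis using subspace_U[of "q - 1"] q unfolding tail_def by simp
qed

lemma dev_tail_zero:
  assumes "x \<in> tail (i + 2)"
  shows "a i x = 0"
proof -
  have "(\<Union>j\<in>{i + 2..<q}. U j) \<subseteq> {x. a i x = 0}" using orth by auto
  then have "tail (i + 2) \<subseteq> {x. a i x = 0}"
    unfolding tail_def by (rule span_minimal[OF _ endo.linear_subspace_kernel[OF endomorphism_dev]])
  then show ?thesis using assms by auto
qed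

text \<open>\<open>a (i - 1)\<close> vanishes on \<open>tail (i + 1)\<close> but not on
  \<open>U i\<close>; the index below \<open>i\<close> accounts for the bound
  \<open>1 \<le> i\<close>.\<close>

lemma dim_tail_strict:
  assumes perf: "perfect q \<sigma> V" and V0: "V \<noteq> {0}" and i: "1 \<le> i" "Suc i < q"
  shows "dim (tail (Suc i)) < dim (tail i)"
proof (rule dim_psubspace[OF findim_tail subspace_tail])
  obtain p where p: "i = Suc p" using i(1) by (cases i) auto
  obtain x where x: "x \<in> V" "a p (a i x) \<noteq> 0"
    using dev_dev_Suc_nonzero[OF perf V0, of p] i p by auto
  have "a i x \<notin> tail (Suc i)" using dev_tail_zero[of "a i x" p] x(2) p by auto
  moreover have "a i x \<in> tail i" using U_subset_tail[of i i] i x(1) by auto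
  ultimately show "tail (Suc i) \<subset> tail i" using tail_Suc_subset by blast
qed

lemma dim_tail_ge:
  assumes perf: "perfect q \<sigma> V" and V0: "V \<noteq> {0}" and i: "1 \<le> i"
  shows "i + k < q \<Longrightarrow> dim (tail (i + k)) + k \<le> dim (tail i)"
proof (induction k)
  case (Suc k)
  then show ?case using dim_tail_strict[OF perf V0, of "i + k"] i by simp
qed simp

text \<open>\<open>tail (q - 1)\<close> is nonzero, and \<open>q - 2\<close> strict inclusions lead
  from it up to \<open>tail 1\<close>.\<close>

lemma dim_perfect_ge:
  assumes perf: "perfect q \<sigma> V" and V0: "V \<noteq> {0}" and q: "2 \<le> q"
  shows "q - 1 \<le> dim V"
proof -
  obtain x where x: "x \<in> V" "a (q - 2) (a (q - 1) x) \<noteq> 0"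
    using dev_dev_Suc_nonzero[OF perf V0, of "q - 2"] q by (auto simp: Suc_diff_Suc numeral_2_eq_2)
  have "a (q - 1) x \<noteq> 0" using x(2) by (auto simp: dev_simps)
  then have "U (q - 1) \<noteq> {0}" using x(1) by blast
  then have "1 \<le> dim (tail (q - 1))"
    using findim_dim_0[OF findim_U[of "q - 1"]] tail_last q by (simp add: Suc_le_eq)
  moreover have "dim (tail (1 + (q - 2))) + (q - 2) \<le> dim (tail 1)"
    using dim_tail_ge[OF perf V0, of 1 "q - 2"] q by simp
  moreover have "1 + (q - 2) = q - 1" using q by simp
  ultimately show ?thesis using dim_subspace_mono[OF findim_V subspace_tail tail_subset, of 1] by simp
qed

end

section \<open>Lower bound for the dimension of arbitrary perfect modules\<close>

context complex_vector_space
begin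

text \<open>A counterexample would have dimension below twice the bound known for
  \<open>q - 2\<close> generators. Then its distant products vanish for some \<open>c\<close>, and
  \<open>dim_perfect_ge\<close> contradicts its smallness.\<close>

lemma dim_perfect_braid_module_ge:
  assumes "braid_module (*s) q \<sigma> V" "perfect q \<sigma> V" "V \<noteq> {0}" "6 \<le> q"
  shows "q - 1 \<le> dim V"
  using assms
proof (induction q arbitrary: \<sigma> V rule: less_induct)
  case (less q)
  interpret braid_module "(*s)" q \<sigma> V by (rule less.prems(1))
  note perf = less.prems(2) and V0 = less.prems(3) and q = less.prems(4)
  show ?case
  proof (rule ccontr)
    assume "\<not> q - 1 \<le> dim V"
    then have small: "dim V \<le> q - 2" by simp
    \<comment> \<open>Bound for \<open>q - 2\<close> generators: the induction hypothesis gives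
      \<open>q - 3\<close> once \<open>q - 2\<close> is at least 6; for 4 or 5 generators it is the
      3 of \<open>dim_perfect_ge_3\<close>.\<close>
    define s where "s = (if q < 8 then 3 else q - 3)"
    have "dim V < 2 * s" using small q by (auto simp: s_def split: if_splits)
    moreover have "s \<le> dim Y" if Y: "submodule (q - 2) (\<lambda>i. \<sigma> (i + 2)) V Y"
      "perfect (q - 2) (\<lambda>i. \<sigma> (i + 2)) Y" "Y \<noteq> {0}" for Y
    proof -
      have bY: "braid_module (*s) (q - 2) (\<lambda>i. \<sigma> (i + 2)) Y"
        using braid_module.braid_module_submodule[OF braid_module_shift Y(1)] .
      show ?thesis
      proof (cases "q < 8")
        case True
        then show ?thesis using braid_module.dim_perfect_ge_3[OF bY _ Y(2,3)] q by (simp add: s_def)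
      next
        case False
        then show ?thesis using less.IH[OF _ bY Y(2,3)] by (simp add: s_def)
      qed
    qed
    ultimately obtain c where "c \<noteq> 0"
      "\<And>i j x. i + 2 \<le> j \<Longrightarrow> j < q \<Longrightarrow> x \<in> V \<Longrightarrow> dev c i (dev c j x) = 0"
      using ex_dev_dev_zero[OF q perf V0, of s] by blast
    then interpret orthogonal_braid_module "(*s)" q \<sigma> V c by unfold_locales
    show False using dim_perfect_ge[OF perf V0] \<open>\<not> q - 1 \<le> dim V\<close> q by simp
  qed
qed

end

section \<open>Corank bounds for irreducible modules with vanishing distant products\<close>

locale irreducible_orthogonal_braid_module = orthogonal_braid_module scale q \<sigma> V c
  for scale :: "complex \<Rightarrow> 'b::ab_group_add \<Rightarrow> 'b" (infixr \<open>*s\<close> 75) and q \<sigma> V c +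
  assumes irreducible: "\<And>W. submodule q \<sigma> V W \<Longrightarrow> W = {0} \<or> W = V"
    and q: "4 \<le> q" and dim_V: "q + 2 \<le> dim V"
    and perf: "perfect q \<sigma> V"
begin

lemma V_nonzero: "V \<noteq> {0}"
  using dim_V by auto

lemma dev_closed_submodule:
  assumes "subspace W" "W \<subseteq> V" "\<And>i x. i < q \<Longrightarrow> x \<in> W \<Longrightarrow> a i x \<in> W"
  shows "submodule q \<sigma> V W"
proof -
  have "\<sigma> i x \<in> W" if i: "i < q" and x: "x \<in> W" for i x
    by (subst generator_eq) (rule subspace_add[OF assms(1) assms(3)[OF i x] subspace_scale[OF assms(1) x]])
  then show ?thesis using assms(1,2) by (simp add: submodule_def)
qed

text \<open>At most \<open>q\<close> vectors cannot span \<open>V\<close>, whose dimension is at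
  least \<open>q + 2\<close>; by irreducibility their invariant span is zero.\<close>

lemma span_finite_submodule:
  assumes B: "finite B" "B \<subseteq> V" "\<And>i x. i < q \<Longrightarrow> x \<in> B \<Longrightarrow> a i x \<in> span B"
    and small: "card B \<le> q"
  shows "B \<subseteq> {0}"
proof -
  have "a i x \<in> span B" if i: "i < q" and x: "x \<in> span B" for i x
  proof -
    have "a i ` B \<subseteq> span B" using B(3)[OF i] by auto
    then have "span (a i ` B) \<subseteq> span B" by (rule span_minimal[OF _ subspace_span])
    then show ?thesis using x endo.linear_span_image[OF endomorphism_dev, of c i B] by auto
  qed
  then have "submodule q \<sigma> V (span B)"
    using span_minimal[OF B(2) subspace_V] by (intro dev_closed_submodule) auto
  moreover have "dim (span B) \<le> q" using dim_le_card[of "span B" B] B(1) small by simp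
  ultimately have "span B = {0}" using irreducible[of "span B"] dim_V by auto
  then show ?thesis using span_superset[of B] by simp
qed

text \<open>The sum of all ranges is invariant and nonzero.\<close>

lemma tail_0: "tail 0 = V"
proof -
  have "submodule q \<sigma> V (tail 0)"
    by (rule dev_closed_submodule[OF subspace_tail tail_subset])
      (use U_subset_tail[of 0] tail_subset in blast)
  moreover have "tail 0 \<noteq> {0}"
  proof
    assume t: "tail 0 = {0}"
    obtain x where "x \<in> V" "a 0 (a (Suc 0) x) \<noteq> 0"
      using dev_dev_Suc_nonzero[OF perf V_nonzero, of 0] q by auto
    moreover have "a (Suc 0) x \<in> tail 0" if "x \<in> V" for x
      using U_subset_tail[of 0 "Suc 0"] q that by auto
    ultimately show False using t by (auto simp: dev_simps)
  qed
  ultimately show ?thesis using irreducible by blast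
qed

lemma \<delta>_U: "Suc i < q \<Longrightarrow> \<delta> ` U i = U (Suc i)"
proof -
  assume i: "Suc i < q"
  have "\<delta> ` U i = (\<lambda>x. \<delta> (a i x)) ` V" by (simp add: image_image)
  also have "\<dots> = (\<lambda>x. a (Suc i) (\<delta> x)) ` V" using \<delta>_dev[OF i] by (intro image_cong) auto
  also have "\<dots> = a (Suc i) ` (\<delta> ` V)" by (simp add: image_image)
  finally show ?thesis using \<delta>_submodule[OF submodule_V] by simp
qed

lemma \<delta>_inj_on: "inj_on \<delta> V"
proof (rule inj_onI)
  fix x y assume "x \<in> V" "y \<in> V" "\<delta> x = \<delta> y"
  then have "x - y \<in> V" "\<delta> (x - y) = 0" using subspace_diff[OF subspace_V] by (simp_all add: seg_simps)
  then show "x = y" using seg_inj[OF order_refl, of "x - y"] by simp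
qed

lemma dim_\<delta>: "subspace W \<Longrightarrow> W \<subseteq> V \<Longrightarrow> dim (\<delta> ` W) = dim W"
proof -
  assume W: "subspace W" "W \<subseteq> V"
  have "{x \<in> W. \<delta> x = 0} = {0}"
    using seg_inj[OF order_refl] W subspace_0[OF W(1)] by (auto simp: seg_simps)
  then show ?thesis using rank_nullity[OF endomorphism_seg findim_mono[OF findim_V W(2,1)], of q] by simp
qed

text \<open>Since \<open>a 0\<close> is \<open>c\<close> times \<open>\<sigma> 0 / c - 1\<close>,
  this is the corank after division by \<open>c\<close>. Conjugation by \<open>\<delta>\<close>
  makes \<open>k\<close> and \<open>e\<close> independent of the position.\<close>

definition k :: nat where "k = dim (U 0)"

definition e :: nat where "e = dim (U 0 \<inter> U 1)"

lemma dim_U: "i < q \<Longrightarrow> dim (U i) = k"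
proof (induction i)
  case (Suc i)
  then show ?case using dim_\<delta>[OF subspace_U U_subset, of i] \<delta>_U[of i] by simp
qed (simp add: k_def)

lemma dim_U_Int: "Suc i < q \<Longrightarrow> dim (U i \<inter> U (Suc i)) = e"
proof (induction i)
  case (Suc i)
  have "\<delta> ` (U i \<inter> U (Suc i)) = \<delta> ` U i \<inter> \<delta> ` U (Suc i)"
    using Suc.prems U_subset[of i] U_subset[of "Suc i"] by (intro inj_on_image_Int[OF \<delta>_inj_on]) auto
  also have "\<dots> = U (Suc i) \<inter> U (Suc (Suc i))" using \<delta>_U Suc.prems by simp
  finally show ?case
    using dim_\<delta>[of "U i \<inter> U (Suc i)"] Suc subspace_inter[OF subspace_U[of i] subspace_U[of "Suc i"]]
      U_subset[of i] by (simp add: le_infI1)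
qed (simp add: e_def)

lemma common_kernel_zero:
  assumes "x \<in> V" "\<And>j. j < q \<Longrightarrow> a j x = 0"
  shows "x = 0"
  using span_finite_submodule[of "{x}"] assms q by (simp add: span_zero)

text \<open>Every index is distant from 0 or from 3, so a common vector is killed by all
  \<open>a j\<close>.\<close>

lemma U_0_Int_U_3: "U 0 \<inter> U 3 = {0}"
proof -
  have "x = 0" if x: "x \<in> U 0" "x \<in> U 3" for x
  proof (rule common_kernel_zero)
    show "x \<in> V" using x(1) U_subset[of 0] q by auto
    fix j assume j: "j < q"
    show "a j x = 0"
    proof (cases "2 \<le> j")
      case True
      then show ?thesis using x(1) j orth'[of 0 j] by auto
    next
      case False
      then show ?thesis using x(2) q orth[of j 3] by auto
    qed
  qed
  moreover have "0 \<in> U 0 \<inter> U 3" using subspace_0[OF subspace_U[of 0]] subspace_0[OF subspace_U[of 3]] q by simp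
  ultimately show ?thesis by blast
qed

text \<open>If \<open>U 0\<close> and \<open>U 1\<close> met trivially, the string of vectors obtained from an eigenvector
  \<open>u\<close> of \<open>a 0\<close> in \<open>U 0\<close> by applying \<open>a 1\<close>, \<open>a 2\<close>, \<open>\<dots>\<close> would span a submodule,
  as in the reduced Burau representation.\<close>

primrec string :: "'b \<Rightarrow> nat \<Rightarrow> 'b" where
  "string u 0 = u"
| "string u (Suc i) = a (Suc i) (string u i)"

lemma e_pos: "0 < e"
proof (rule ccontr)
  assume "\<not> 0 < e"
  then have "dim (U 0 \<inter> U 1) = 0" by (simp add: e_def)
  moreover have "findim (U 0 \<inter> U 1)"
    using findim_mono[OF findim_U[of 0] _ subspace_inter[OF subspace_U subspace_U]] q by simp
  ultimately have int0: "U 0 \<inter> U 1 = {0}" using findim_dim_0 by simp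
  have R: "(c * c) *s a i x + c *s a i (a i x) + a i (a (Suc i) (a i x)) = 0"
    if "Suc i < q" "x \<in> V" for i x
    using that
  proof (induction i arbitrary: x)
    case 0
    \<comment> \<open>The two sides of \<open>braid_dev\<close> lie in \<open>U 0\<close> and
      \<open>U 1\<close>, which meet trivially, so both vanish; conjugation by
      \<open>\<delta>\<close> carries this to all \<open>i\<close>.\<close>
    let ?l = "\<lambda>i j. (c * c) *s a i x + c *s a i (a i x) + a i (a j (a i x))"
    have mem: "?l i j \<in> U i" if "i < q" "j < q" for i j
      using that 0(2) subspace_add[OF subspace_U] subspace_scale[OF subspace_U] dev_stable by simp
    have "?l 0 1 = ?l 1 0" using braid_dev[OF 0] by simp
    then have "?l 0 1 \<in> U 0 \<inter> U 1" using mem[of 0 1] mem[of 1 0] q by simp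
    then show ?case unfolding int0 by simp
  next
    case (Suc i)
    obtain y where y: "y \<in> V" "x = \<delta> y" using \<delta>_surj[OF Suc.prems(2)] .
    have "(c * c) *s a (Suc i) x + c *s a (Suc i) (a (Suc i) x) + a (Suc i) (a (Suc (Suc i)) (a (Suc i) x))
      = \<delta> ((c * c) *s a i y + c *s a i (a i y) + a i (a (Suc i) (a i y)))"
      using y Suc.prems by (simp add: seg_simps \<delta>_dev dev_stable)
    also have "\<dots> = \<delta> 0" using Suc.IH[of y] Suc.prems y by simp
    finally show ?case by (simp add: seg_simps)
  qed
  have R': "(c * c) *s a (Suc i) x + c *s a (Suc i) (a (Suc i) x) + a (Suc i) (a i (a (Suc i) x)) = 0"
    if "Suc i < q" "x \<in> V" for i x
    using R[OF that] braid_dev[OF that] by simp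
  have U0_nonzero: "U 0 \<noteq> {0}"
  proof
    assume U0: "U 0 = {0}"
    obtain x where "x \<in> V" "a 0 (a (Suc 0) x) \<noteq> 0"
      using dev_dev_Suc_nonzero[OF perf V_nonzero, of 0] q by auto
    then show False using U0 dev_stable[of "Suc 0" x c] q by auto
  qed
  have st: "a 0 ` U 0 \<subseteq> U 0" using U_subset[of 0] q by auto
  obtain \<nu> u0 where u0: "u0 \<in> U 0" "u0 \<noteq> 0" "a 0 u0 = \<nu> *s u0"
    using ex_eigenvector[OF endomorphism_dev findim_U[of 0] U0_nonzero st] q
    by (metis gr0I not_numeral_le_zero)
  \<comment> \<open>Chosen so that \<open>R\<close> reads \<open>a i (a (i + 1) u) = \<mu> u\<close>
    for an eigenvector \<open>u\<close> of \<open>a i\<close> in \<open>U i\<close> with eigenvalue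
    \<open>\<nu>\<close>.\<close>
  define \<mu> where "\<mu> = - (c * c + c * \<nu>)"
  let ?u = "string u0"
  have uU: "?u i \<in> U i" if "i < q" for i
    using that
  proof (induction i)
    case (Suc i)
    then show ?case using U_subset[of i] by auto
  qed (use u0 in simp)
  have uV: "?u i \<in> V" if "i < q" for i using uU[OF that] U_subset[OF that] by auto
  have down: "a i (?u (Suc i)) = \<mu> *s ?u i" if i: "Suc i < q" and ev: "a i (?u i) = \<nu> *s ?u i" for i
  proof -
    obtain w where w: "w \<in> V" "?u i = a i w" using uU[of i] i by auto
    have "(c * c) *s ?u i + c *s a i (?u i) + a i (a (Suc i) (?u i)) = 0"
      using R[OF i w(1)] unfolding w(2) .
    then have "a i (a (Suc i) (?u i)) = - ((c * c) *s ?u i + c *s \<nu> *s ?u i)"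
      unfolding ev using eq_neg_iff_add_eq_0 by (metis add.commute)
    then show ?thesis by (simp add: \<mu>_def scale_left_distrib scale_left_diff_distrib)
  qed
  \<comment> \<open>The eigenvalue passes along the string: in \<open>R'\<close>,
    \<open>down\<close> replaces the cubic term by a multiple of the next vector, and the choice of
    \<open>\<mu>\<close> leaves the eigenvalue equation times \<open>c\<close>.\<close>
  have ev: "a i (?u i) = \<nu> *s ?u i" if "i < q" for i
    using that
  proof (induction i)
    case (Suc i)
    let ?b = "a (Suc i)"
    have i: "i < q" using Suc.prems by simp
    have "a i (?b (?u i)) = \<mu> *s ?u i" using down[OF Suc.prems Suc.IH[OF i]] by simp
    then have "(c * c) *s ?b (?u i) + c *s ?b (?b (?u i)) + \<mu> *s ?b (?u i) = 0"
      using R'[OF Suc.prems uV[OF i]] by (simp add: dev_simps)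
    then have "c *s (?b (?b (?u i)) - \<nu> *s ?b (?u i)) = 0"
      by (simp add: \<mu>_def algebra_simps)
    then show ?case using c0 by simp
  qed (use u0 in simp)
  let ?B = "?u ` {..<q}"
  have "?B \<subseteq> {0}"
  proof (rule span_finite_submodule)
    show "?B \<subseteq> V" using uV by auto
    show "card ?B \<le> q" using card_image_le[of "{..<q}" ?u] by simp
    fix i x assume i: "i < q" and "x \<in> ?B"
    then obtain j where j: "j < q" "x = ?u j" by auto
    have B: "?u l \<in> span ?B" if "l < q" for l using that by (intro span_base) simp
    obtain w where w: "w \<in> V" "?u j = a j w" using uU[OF j(1)] by auto
    \<comment> \<open>\<open>a i\<close> maps each \<open>?u j\<close> to a multiple of
      \<open>?u i\<close>, with factor \<open>\<mu>\<close>, \<open>\<nu>\<close>, 1 for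
      \<open>j = i + 1\<close>, \<open>i\<close>, \<open>i - 1\<close> and zero otherwise.\<close>
    consider "i + 2 \<le> j" | "j = Suc i" | "i = j" | "i = Suc j" | "j + 2 \<le> i" by linarith
    then show "a i x \<in> span ?B"
    proof cases
      case 1
      then show ?thesis using orth[of i j w] j w span_zero by simp
    next
      case 2
      then show ?thesis using down[OF _ ev[OF i]] j B[OF i] span_scale by simp
    next
      case 3
      then show ?thesis using ev j B span_scale by simp
    next
      case 4
      then show ?thesis using B[of "Suc j"] i j by simp
    next
      case 5
      then show ?thesis using orth'[of j i w] i j w span_zero by simp
    qed
  qed simp
  moreover have "u0 \<in> ?B" using q by (intro image_eqI[of _ _ 0]) auto
  ultimately show False using u0 by auto
qed

text \<open>Each further \<open>U j\<close> meets its neighbour in all but at most one dimension, so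
  it enlarges the sum by at most one.\<close>

lemma dim_tail_le:
  assumes "k \<le> e + 1"
  shows "i < q \<Longrightarrow> dim (tail (q - 1 - i)) \<le> k + i"
proof (induction i)
  case 0
  then show ?case using tail_last dim_U[of "q - 1"] by simp
next
  case (Suc i)
  define j where "j = q - 1 - Suc i"
  have j: "Suc j = q - 1 - i" "Suc j < q" using Suc.prems by (auto simp: j_def)
  have "U j \<inter> U (Suc j) \<subseteq> U j \<inter> tail (Suc j)" using U_subset_tail[of "Suc j" "Suc j"] j by auto
  moreover have sub: "subspace (U j \<inter> U (Suc j))" "subspace (U j \<inter> tail (Suc j))"
    using subspace_inter subspace_U subspace_tail j by (metis Suc_lessD)+
  moreover have "findim (U j \<inter> tail (Suc j))"
    using findim_mono[OF findim_U[of j] _ sub(2)] j by simp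
  ultimately have "e \<le> dim (U j \<inter> tail (Suc j))"
    using dim_subspace_mono dim_U_Int[OF j(2)] by metis
  moreover have "dim (tail j) + dim (U j \<inter> tail (Suc j)) = k + dim (tail (Suc j))"
    using dim_span_Un_Int[OF findim_U[of j] findim_tail[of "Suc j"]] tail_rec[of j] dim_U[of j] j
    by simp
  moreover have "dim (tail (Suc j)) \<le> k + i" using Suc j by simp
  ultimately have "dim (tail j) \<le> k + Suc i" using assms by simp
  then show ?case unfolding j_def .
qed

text \<open>For \<open>k \<le> 2\<close>, positivity of \<open>e\<close> makes
  \<open>dim_tail_le\<close> applicable down to \<open>tail 0 = V\<close> and gives
  \<open>dim V \<le> q + 1\<close>.\<close>

lemma k_ge_3: "3 \<le> k"
proof (rule ccontr)
  assume "\<not> 3 \<le> k"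
  then have "dim V \<le> k + (q - 1)" "k \<le> 2" using dim_tail_le[of "q - 1"] e_pos q tail_0 by auto
  then show False using dim_V q by simp
qed

text \<open>Consecutive triple intersections have dimension at least \<open>2 * e - k\<close>. Two
  of them lie in \<open>U 1 \<inter> U 2\<close> and meet inside
  \<open>U 0 \<inter> U 3 = {0}\<close>, so \<open>2 * (2 * e - k) \<le> e\<close>. With
  \<open>k \<le> e + 1\<close> this yields \<open>e \<le> 2\<close> and
  \<open>k \<le> 3\<close>.\<close>

lemma k_le_3:
  assumes "k \<le> e + 1"
  shows "k \<le> 3"
proof -
  have triple: "2 * e \<le> k + dim (U i \<inter> U (Suc i) \<inter> U (Suc (Suc i)))" if i: "Suc (Suc i) < q" for i
  proof -
    have "U i \<inter> U (Suc i) \<inter> (U (Suc i) \<inter> U (Suc (Suc i))) = U i \<inter> U (Suc i) \<inter> U (Suc (Suc i))" by auto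
    moreover have "dim (U i \<inter> U (Suc i)) + dim (U (Suc i) \<inter> U (Suc (Suc i)))
      \<le> dim (U (Suc i)) + dim (U i \<inter> U (Suc i) \<inter> (U (Suc i) \<inter> U (Suc (Suc i))))"
      using i by (intro dim_Int_ge findim_U subspace_inter subspace_U) auto
    ultimately show ?thesis using dim_U[of "Suc i"] dim_U_Int[of i] dim_U_Int[of "Suc i"] i by simp
  qed
  let ?A = "U 0 \<inter> U 1 \<inter> U 2" and ?B = "U 1 \<inter> U 2 \<inter> U 3" and ?C = "U 1 \<inter> U 2"
  have C: "findim ?C"
    using findim_mono[OF findim_U[of 1] _ subspace_inter[OF subspace_U subspace_U]] q by simp
  have "dim ?A + dim ?B \<le> dim ?C + dim (?A \<inter> ?B)"
    using q by (intro dim_Int_ge C subspace_inter subspace_U) auto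
  moreover have "?A \<inter> ?B = {0}"
  proof -
    have "?A \<inter> ?B \<subseteq> U 0 \<inter> U 3" by auto
    moreover have "subspace (?A \<inter> ?B)" using q by (intro subspace_inter subspace_U) auto
    ultimately show ?thesis using subspace_0 U_0_Int_U_3 by blast
  qed
  moreover have "dim ?C = e" using dim_U_Int[of 1] q by (simp add: numeral_2_eq_2)
  ultimately show ?thesis
    using triple[of 0] triple[of 1] q assms by (simp add: numeral_2_eq_2 numeral_3_eq_3)
qed

text \<open>If \<open>k \<le> e + 1\<close>, then \<open>k \<le> 3\<close>, which is enough because
  \<open>dim V \<ge> q + 2\<close>. Otherwise the last two ranges span dimension
  \<open>2 * k - e \<ge> k + 2\<close>, and \<open>q - 3\<close> strict inclusions lead from there
  up to \<open>tail 1\<close>.\<close>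

lemma k_le: "k \<le> dim V + 1 - q"
proof (cases "k \<le> e + 1")
  case True
  then show ?thesis using k_le_3 dim_V by simp
next
  case False
  define j where "j = q - 2"
  have j: "Suc j = q - 1" "Suc j < q" "j < q" "1 + (q - 3) = j" using q by (auto simp: j_def)
  have "dim (tail j) + dim (U j \<inter> tail (Suc j)) = k + dim (tail (Suc j))"
    using dim_span_Un_Int[OF findim_U[OF j(3)] findim_tail[of "Suc j"]] tail_rec[OF j(3)] dim_U[OF j(3)]
    by simp
  moreover have "tail (Suc j) = U (Suc j)" using tail_last j q by simp
  ultimately have "dim (tail j) + e = k + k" using dim_U[OF j(2)] dim_U_Int[OF j(2)] by simp
  then have "k + 2 \<le> dim (tail j)" using False by simp
  moreover have "dim (tail j) + (q - 3) \<le> dim (tail 1)"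
    using dim_tail_ge[OF perf V_nonzero, of 1 "q - 3"] j q by simp
  ultimately show ?thesis
    using dim_subspace_mono[OF findim_V subspace_tail tail_subset, of 1] q by simp
qed

end

section \<open>Irreducible braid modules in the given range of dimensions\<close>

context braid_module
begin

theorem irreducible_dev_dim:
  assumes irr: "\<And>W. submodule q \<sigma> V W \<Longrightarrow> W = {0} \<or> W = V"
    and q: "9 \<le> q" and d: "q + 2 \<le> dim V" "dim V \<le> 2 * q - 7"
  obtains c where "c \<noteq> 0" "3 \<le> dim (dev c 0 ` V)" "dim (dev c 0 ` V) \<le> dim V + 1 - q"
proof -
  have V0: "V \<noteq> {0}" using d by auto
  have perf: "perfect q \<sigma> V"
    unfolding perfect_def
  proof (intro allI impI)
    fix W assume W: "submodule q \<sigma> V W" and D: "absorbs_differences q \<sigma> V W"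
    show "W = V"
    proof (rule ccontr)
      assume "W \<noteq> V"
      \<comment> \<open>All generators now act as the same operator, so an eigenvector spans a
        submodule; this forces dimension at most 1.\<close>
      then have W0: "W = {0}" using irr[OF W] by simp
      have eq: "\<sigma> i x = \<sigma> 0 x" if "i < q" "x \<in> V" for i x
        using absorbs_differencesD[OF D that(1) _ that(2), of 0] q W0 by simp
      have "\<sigma> 0 ` V \<subseteq> V" using stable[of 0] q by auto
      then obtain l v where v: "v \<in> V" "v \<noteq> 0" "\<sigma> 0 v = l *s v"
        using ex_eigenvector[OF lin findim_V V0] by metis
      have "submodule q \<sigma> V (span {v})"
        unfolding submodule_def
      proof (intro conjI allI impI ballI)
        show "span {v} \<subseteq> V" using span_minimal[OF _ subspace_V] v(1) by simp
        fix i x assume i: "i < q" and "x \<in> span {v}"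
        then obtain b where "x = b *s v" by (auto simp: span_singleton)
        then have "\<sigma> i x = (b * l) *s v" using eq[OF i v(1)] v(3) by (simp add: lin_simps)
        then show "\<sigma> i x \<in> span {v}" by (auto simp: span_singleton)
      qed simp
      moreover have "span {v} \<noteq> {0}" using v(2) span_superset[of "{v}"] by auto
      ultimately have "V = span {v}" using irr by metis
      then have "dim V \<le> 1" using dim_le_card[of V "{v}"] by simp
      then show False using d by simp
    qed
  qed
  have big: "q - 3 \<le> dim Y" if Y: "submodule (q - 2) (\<lambda>i. \<sigma> (i + 2)) V Y"
    "perfect (q - 2) (\<lambda>i. \<sigma> (i + 2)) Y" "Y \<noteq> {0}" for Y
    using dim_perfect_braid_module_ge[OF braid_module.braid_module_submodule[OF braid_module_shift Y(1)] Y(2,3)] q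
    by simp
  \<comment> \<open>The upper bound \<open>2 * q - 7\<close> on the dimension is exactly one less
    than twice the bound \<open>q - 3\<close> for \<open>q - 2\<close> generators.\<close>
  have "6 \<le> q" and small: "dim V < 2 * (q - 3)" using q d by auto
  obtain c where c: "c \<noteq> 0"
    "\<And>i j x. i + 2 \<le> j \<Longrightarrow> j < q \<Longrightarrow> x \<in> V \<Longrightarrow> dev c i (dev c j x) = 0"
    using ex_dev_dev_zero[OF \<open>6 \<le> q\<close> perf V0 _ small] big by blast
  then interpret O: irreducible_orthogonal_braid_module "(*s)" q \<sigma> V c
    using irr q d perf by unfold_locales auto
  show ?thesis
    using that[OF c(1)] O.k_ge_3 O.k_le by (simp add: O.k_def)
qed

end

section \<open>Matrices acting on coordinate space\<close>

definition fscale :: "complex \<Rightarrow> (nat \<Rightarrow> complex) \<Rightarrow> nat \<Rightarrow> complex" where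
  "fscale c f = (\<lambda>i. c * f i)"

interpretation fun_space: complex_vector_space fscale
  by unfold_locales (simp_all add: fscale_def fun_eq_iff algebra_simps)

definition ext :: "nat \<Rightarrow> complex vec \<Rightarrow> nat \<Rightarrow> complex" where
  "ext r v = (\<lambda>i. if i < r then v $ i else 0)"

text \<open>Complex \<open>r\<close>-space as sequences vanishing from index \<open>r\<close> on, so
  that one type serves every dimension.\<close>

definition coord_space :: "nat \<Rightarrow> (nat \<Rightarrow> complex) set" where
  "coord_space r = {f. \<forall>i\<ge>r. f i = 0}"

definition act :: "nat \<Rightarrow> complex mat \<Rightarrow> (nat \<Rightarrow> complex) \<Rightarrow> nat \<Rightarrow> complex" where
  "act r A f = ext r (A *\<^sub>v vec r f)"

lemma vec_ext: "v \<in> carrier_vec r \<Longrightarrow> vec r (ext r v) = v"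
  by (auto simp: ext_def)

lemma ext_vec: "f \<in> coord_space r \<Longrightarrow> ext r (vec r f) = f"
  by (auto simp: ext_def coord_space_def fun_eq_iff)

lemma ext_in: "ext r v \<in> coord_space r"
  by (simp add: ext_def coord_space_def)

lemma coord_space_eq: "coord_space r = ext r ` carrier_vec r"
proof
  show "coord_space r \<subseteq> ext r ` carrier_vec r"
  proof
    fix f assume "f \<in> coord_space r"
    then show "f \<in> ext r ` carrier_vec r"
      by (intro image_eqI[of _ _ "vec r f"]) (simp_all add: ext_vec)
  qed
qed (auto simp: ext_in)

lemma inj_on_ext: "inj_on (ext r) (carrier_vec r)"
  by (rule inj_on_inverseI[of _ "vec r"]) (rule vec_ext)

lemma ext_add: "v \<in> carrier_vec r \<Longrightarrow> w \<in> carrier_vec r \<Longrightarrow> ext r (v + w) = ext r v + ext r w"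
  by (auto simp: ext_def fun_eq_iff)

lemma ext_smult: "v \<in> carrier_vec r \<Longrightarrow> ext r (c \<cdot>\<^sub>v v) = fscale c (ext r v)"
  by (auto simp: ext_def fscale_def fun_eq_iff)

lemma ext_zero: "ext r (0\<^sub>v r) = 0"
  by (auto simp: ext_def fun_eq_iff)

lemma act_in: "act r A f \<in> coord_space r"
  by (simp add: act_def ext_in)

lemma act_ext: "v \<in> carrier_vec r \<Longrightarrow> act r A (ext r v) = ext r (A *\<^sub>v v)"
  by (simp add: act_def vec_ext)

lemma act_mult:
  assumes "A \<in> carrier_mat r r" "B \<in> carrier_mat r r"
  shows "act r (A * B) f = act r A (act r B f)"
proof -
  have "B *\<^sub>v vec r f \<in> carrier_vec r" using assms by simp
  then show ?thesis using assms by (simp add: act_def vec_ext assoc_mult_mat_vec[of _ r r _ r])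
qed

lemma act_one: "f \<in> coord_space r \<Longrightarrow> act r (1\<^sub>m r) f = f"
  by (simp add: act_def ext_vec)

lemma act_eq_sum:
  assumes "A \<in> carrier_mat r r"
  shows "act r A f = (\<lambda>i. if i < r then \<Sum>j<r. A $$ (i, j) * f j else 0)"
  using assms by (auto simp: act_def ext_def fun_eq_iff scalar_prod_def atLeast0LessThan intro!: sum.cong)

lemma endomorphism_act:
  assumes "A \<in> carrier_mat r r"
  shows "fun_space.endomorphism (act r A)"
  unfolding Vector_Spaces.linear_iff act_eq_sum[OF assms]
  using fun_space.vector_space_axioms
  by (auto simp: fun_eq_iff fscale_def sum.distrib sum_distrib_left distrib_left mult.left_commute)

lemma subspace_coord_space: "fun_space.subspace (coord_space r)"
  by (rule fun_space.subspaceI) (auto simp: coord_space_def fscale_def)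

section \<open>Linear independence and matrix rank in the coordinate model\<close>

lemma sum_fun_apply: "sum g T i = (\<Sum>v\<in>T. g v i)" for g :: "'a \<Rightarrow> nat \<Rightarrow> complex"
  by (induction T rule: infinite_finite_induct) auto

text \<open>\<open>ext r\<close> is injective and turns linear combinations into linear
  combinations; coefficients are transported along it and its inverse \<open>vec r\<close>.\<close>

lemma independent_ext_iff:
  assumes finT: "finite T" and T: "T \<subseteq> carrier_vec r"
  shows "fun_space.independent (ext r ` T)
    \<longleftrightarrow> \<not> LinearCombinations.module.lin_dep class_ring (module_vec TYPE(complex) r) T"
proof -
  interpret vec_space "TYPE(complex)" r .
  have inj: "inj_on (ext r) T" using inj_on_subset[OF inj_on_ext T] .
  have comb: "ext r (lincomb a T) = (\<Sum>v\<in>T. fscale (a v) (ext r v))" for a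
    using lincomb_index[OF _ T] by (auto simp: fun_eq_iff sum_fun_apply ext_def fscale_def)
  have closed: "lincomb a T \<in> carrier_vec r" for a
    using lincomb_dim[OF finT T] by (metis carrier_vec_dim_vec)
  have zero: "lincomb a T = 0\<^sub>v r \<longleftrightarrow> (\<Sum>v\<in>T. fscale (a v) (ext r v)) = 0" for a
    using inj_on_eq_iff[OF inj_on_ext closed zero_carrier_vec] unfolding comb ext_zero by simp
  have "lin_dep T \<longleftrightarrow> (\<exists>a. lincomb a T = 0\<^sub>v r \<and> (\<exists>v\<in>T. a v \<noteq> 0))"
  proof
    assume "lin_dep T"
    then show "\<exists>a. lincomb a T = 0\<^sub>v r \<and> (\<exists>v\<in>T. a v \<noteq> 0)"
      using finite_lin_indpt2[OF finT] T by auto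
  next
    assume "\<exists>a. lincomb a T = 0\<^sub>v r \<and> (\<exists>v\<in>T. a v \<noteq> 0)"
    then show "lin_dep T" using lin_dep_crit[OF finT order_refl] by auto
  qed
  also have "\<dots> \<longleftrightarrow> fun_space.dependent (ext r ` T)"
  proof
    assume "\<exists>a. lincomb a T = 0\<^sub>v r \<and> (\<exists>v\<in>T. a v \<noteq> 0)"
    then obtain a v where a: "(\<Sum>v\<in>T. fscale (a v) (ext r v)) = 0" "v \<in> T" "a v \<noteq> 0"
      unfolding zero by blast
    have "(\<Sum>y\<in>ext r ` T. fscale (a (vec r y)) y) = (\<Sum>v\<in>T. fscale (a v) (ext r v))"
      unfolding sum.reindex[OF inj] using T by (intro sum.cong) (auto simp: vec_ext)
    moreover have "a (vec r (ext r v)) \<noteq> 0" using a T by (auto simp: vec_ext)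
    ultimately show "fun_space.dependent (ext r ` T)"
      unfolding fun_space.dependent_finite[OF finite_imageI[OF finT]]
      using a by (intro exI[of _ "\<lambda>y. a (vec r y)"]) auto
  next
    assume "fun_space.dependent (ext r ` T)"
    then obtain u v where u: "(\<Sum>y\<in>ext r ` T. fscale (u y) y) = 0" "v \<in> T" "u (ext r v) \<noteq> 0"
      unfolding fun_space.dependent_finite[OF finite_imageI[OF finT]] by auto
    then have "(\<Sum>v\<in>T. fscale (u (ext r v)) (ext r v)) = 0"
      unfolding sum.reindex[OF inj] by simp
    then show "\<exists>a. lincomb a T = 0\<^sub>v r \<and> (\<exists>v\<in>T. a v \<noteq> 0)"
      unfolding zero using u(2,3) by (intro exI[of _ "\<lambda>v. u (ext r v)"]) auto
  qed
  finally show ?thesis by simp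
qed

lemma act_image_subset_span:
  assumes A: "A \<in> carrier_mat r r"
  shows "act r A ` M \<subseteq> fun_space.span (ext r ` set (cols A))"
proof
  fix y assume "y \<in> act r A ` M"
  then obtain f where "y = act r A f" by auto
  also have "\<dots> = (\<Sum>j<r. fscale (f j) (ext r (col A j)))"
    using A by (auto simp: act_eq_sum fun_eq_iff sum_fun_apply fscale_def ext_def intro!: sum.cong)
  finally have y: "y = (\<Sum>j<r. fscale (f j) (ext r (col A j)))" .
  have "ext r (col A j) \<in> ext r ` set (cols A)" if "j < r" for j
    using A that by (auto simp: cols_def)
  then show "y \<in> fun_space.span (ext r ` set (cols A))"
    unfolding y by (intro fun_space.span_sum fun_space.span_scale fun_space.span_base) auto
qed

text \<open>The rank is the size of a maximal independent set of columns. Maximality makes its image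
  under \<open>ext r\<close> span the columns, hence a basis of the image.\<close>

lemma dim_act_image:
  assumes A: "A \<in> carrier_mat r r"
  shows "fun_space.dim (act r A ` coord_space r) = vec_space.rank r A"
proof -
  interpret vec_space "TYPE(complex)" r .
  let ?P = "\<lambda>T. T \<subseteq> set (cols A) \<and> lin_indpt T"
  have "?P {}" unfolding lin_dep_def by auto
  then obtain S where S: "finite S" "maximal S ?P"
    using maximal_exists_superset[of "set (cols A)" ?P "{}"] by auto
  have PS: "S \<subseteq> set (cols A)" "lin_indpt S" using S(2) by (auto simp: maximal_def)
  have colsA: "set (cols A) \<subseteq> carrier_vec r" using cols_dim[of A] A by simp
  note SC = order_trans[OF PS(1) colsA]
  have ind: "fun_space.independent (ext r ` S)"
    using independent_ext_iff[OF S(1) SC] PS(2) by simp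
  have "ext r v \<in> fun_space.span (ext r ` S)" if v: "v \<in> set (cols A)" for v
  proof (rule ccontr)
    assume nv: "ext r v \<notin> fun_space.span (ext r ` S)"
    have "fun_space.independent (ext r ` insert v S)"
      using fun_space.independent_insertI[OF nv ind] by simp
    then have "lin_indpt (insert v S)"
      using independent_ext_iff[of "insert v S" r] S(1) SC colsA v by auto
    then have "insert v S = S" using S(2) PS v unfolding maximal_def by blast
    then have "ext r v \<in> ext r ` S" by blast
    then show False using nv fun_space.span_base by metis
  qed
  then have "fun_space.span (ext r ` set (cols A)) \<subseteq> fun_space.span (ext r ` S)"
    by (intro fun_space.span_minimal fun_space.subspace_span) auto
  then have sp: "act r A ` coord_space r \<subseteq> fun_space.span (ext r ` S)"
    using act_image_subset_span[OF A] by blast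
  have "ext r ` S \<subseteq> act r A ` coord_space r"
  proof
    fix y assume "y \<in> ext r ` S"
    then obtain j where j: "j < r" "y = ext r (col A j)"
      using PS(1) A by (auto simp: cols_def)
    have "col A j = A *\<^sub>v unit_vec r j"
      using col_mult2[OF A one_carrier_mat j(1)] A j(1) by simp
    then have "y = act r A (ext r (unit_vec r j))"
      using j by (simp add: act_ext)
    then show "y \<in> act r A ` coord_space r" using ext_in by auto
  qed
  then have "fun_space.dim (act r A ` coord_space r) = card (ext r ` S)"
    using fun_space.basis_card_eq_dim[OF _ sp ind] by simp
  also have "\<dots> = card S" by (rule card_image[OF inj_on_subset[OF inj_on_ext SC]])
  also have "\<dots> = rank A" using rank_card_indpt[OF A S(2)] by simp
  finally show ?thesis .
qed

lemma act_one_image: "act r (1\<^sub>m r) ` coord_space r = coord_space r"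
proof -
  have "act r (1\<^sub>m r) ` coord_space r = id ` coord_space r"
    by (rule image_cong) (simp_all add: act_one)
  then show ?thesis by simp
qed

text \<open>The identity matrix has nonzero determinant, hence full rank.\<close>

lemma dim_coord_space: "fun_space.dim (coord_space r) = r"
  using dim_act_image[of "1\<^sub>m r" r] vec_space.low_rank_det_zero[of "1\<^sub>m r :: complex mat" r]
  by (simp add: act_one_image)

lemma findim_coord_space: "fun_space.findim (coord_space r)"
  unfolding fun_space.findim_def
proof (intro conjI subspace_coord_space exI)
  show "finite (ext r ` set (cols (1\<^sub>m r)))" by simp
  show "coord_space r \<subseteq> fun_space.span (ext r ` set (cols (1\<^sub>m r)))"
    using act_image_subset_span[of "1\<^sub>m r" r "coord_space r"] by (simp add: act_one_image)
qed

section \<open>The braid group and its representations\<close>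

lemma GL_carrier: "A \<in> carrier (GL r) \<Longrightarrow> A \<in> carrier_mat r r"
  by (auto simp: GL_def units_of_carrier Units_def ring_mat_simps)

lemma GL_inverse:
  "A \<in> carrier (GL r) \<Longrightarrow> \<exists>B\<in>carrier_mat r r. B * A = 1\<^sub>m r \<and> A * B = 1\<^sub>m r"
  by (auto simp: GL_def units_of_carrier Units_def ring_mat_simps)

lemma GL_I:
  "A \<in> carrier_mat r r \<Longrightarrow> B \<in> carrier_mat r r \<Longrightarrow> B * A = 1\<^sub>m r \<Longrightarrow> A * B = 1\<^sub>m r \<Longrightarrow> A \<in> carrier (GL r)"
  by (auto simp: GL_def units_of_carrier Units_def ring_mat_simps)

lemma GL_mult: "A \<otimes>\<^bsub>GL r\<^esub> B = A * B"
  by (simp add: GL_def units_of_mult ring_mat_simps)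

lemma GL_one: "\<one>\<^bsub>GL r\<^esub> = 1\<^sub>m r"
  by (simp add: GL_def units_of_one ring_mat_simps)

lemma group_GL: "group (GL r)"
proof -
  have "monoid (ring_mat TYPE(complex) r ())" using ring_mat by (rule ring.is_monoid)
  then show ?thesis unfolding GL_def by (rule monoid.units_group)
qed

definition braid_words :: "nat \<Rightarrow> nat gword set" where
  "braid_words n = gwords {1..n - 1}"

definition braid_class :: "nat \<Rightarrow> nat gword \<Rightarrow> nat gword set" where
  "braid_class n = pres_class {1..n - 1} (braid_relations n)"

lemma braid_words_Nil: "[] \<in> braid_words n"
  by (simp add: braid_words_def gwords_def)

lemma braid_words_Cons: "(b, i) # u \<in> braid_words n \<longleftrightarrow> 1 \<le> i \<and> i < n \<and> u \<in> braid_words n"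
  by (auto simp: braid_words_def gwords_def)

lemma braid_words_append: "u \<in> braid_words n \<Longrightarrow> v \<in> braid_words n \<Longrightarrow> u @ v \<in> braid_words n"
  by (simp add: braid_words_def gwords_def)

lemmas braid_words_simps = braid_words_Nil braid_words_Cons braid_words_append

lemma carrier_braid_group: "carrier (braid_group n) = braid_class n ` braid_words n"
  by (simp add: braid_group_def presented_group_def braid_class_def braid_words_def)

lemma one_braid_group: "\<one>\<^bsub>braid_group n\<^esub> = braid_class n []"
  by (simp add: braid_group_def presented_group_def braid_class_def)

lemma mult_braid_class:
  "u \<in> braid_words n \<Longrightarrow> v \<in> braid_words n \<Longrightarrow>
    braid_class n u \<otimes>\<^bsub>braid_group n\<^esub> braid_class n v = braid_class n (u @ v)"
  unfolding braid_group_def braid_class_def braid_words_def by (rule mult_pres_class)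

lemma braid_gen_class: "braid_gen n i = braid_class n [(True, i)]"
  by (simp add: braid_gen_def braid_class_def)

lemma braid_gen_carrier: "1 \<le> i \<Longrightarrow> i < n \<Longrightarrow> braid_gen n i \<in> carrier (braid_group n)"
  unfolding carrier_braid_group braid_gen_class by (intro imageI) (simp add: braid_words_simps)

lemma braid_class_relation:
  assumes "(u, v) \<in> braid_relations n" "u \<in> braid_words n" "v \<in> braid_words n"
  shows "braid_class n u = braid_class n v"
  using pres_class_eq_iff pres_eq.relation assms unfolding braid_words_def braid_class_def by metis

lemma braid_gen_far:
  assumes "1 \<le> i" "i + 2 \<le> j" "j < n"
  shows "braid_gen n i \<otimes>\<^bsub>braid_group n\<^esub> braid_gen n j = braid_gen n j \<otimes>\<^bsub>braid_group n\<^esub> braid_gen n i"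
proof -
  have "([(True, i), (True, j)], [(True, j), (True, i)]) \<in> braid_relations n"
    unfolding braid_relations_def using assms by (intro UnI1 CollectI exI[of _ i] exI[of _ j]) auto
  then have "braid_class n [(True, i), (True, j)] = braid_class n [(True, j), (True, i)]"
    by (rule braid_class_relation) (use assms in \<open>simp_all add: braid_words_simps\<close>)
  then show ?thesis
    using assms by (simp add: braid_gen_class mult_braid_class braid_words_simps)
qed

lemma braid_gen_braid:
  assumes "1 \<le> i" "Suc i < n"
  shows "braid_gen n i \<otimes>\<^bsub>braid_group n\<^esub> (braid_gen n (Suc i) \<otimes>\<^bsub>braid_group n\<^esub> braid_gen n i)
    = braid_gen n (Suc i) \<otimes>\<^bsub>braid_group n\<^esub> (braid_gen n i \<otimes>\<^bsub>braid_group n\<^esub> braid_gen n (Suc i))"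
proof -
  have "([(True, i), (True, Suc i), (True, i)], [(True, Suc i), (True, i), (True, Suc i)])
      \<in> braid_relations n"
    unfolding braid_relations_def using assms by (intro UnI2 CollectI exI[of _ i]) auto
  then have "braid_class n [(True, i), (True, Suc i), (True, i)]
      = braid_class n [(True, Suc i), (True, i), (True, Suc i)]"
    by (rule braid_class_relation) (use assms in \<open>simp_all add: braid_words_simps\<close>)
  then show ?thesis
    using assms by (simp add: braid_gen_class mult_braid_class braid_words_simps)
qed

section \<open>The exponent homomorphism of the braid group and twists by its characters\<close>

definition exponent_sum :: "'a gword \<Rightarrow> int" where
  "exponent_sum u = (\<Sum>(b, x)\<leftarrow>u. if b then 1 else -1)"

lemma exponent_sum_append: "exponent_sum (u @ v) = exponent_sum u + exponent_sum v"
  by (simp add: exponent_sum_def)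

text \<open>Cancelling pairs contribute zero, and the two sides of a braid relation are positive
  words of equal length.\<close>

lemma exponent_sum_pres_eq:
  "pres_eq S (braid_relations n) u v \<Longrightarrow> exponent_sum u = exponent_sum v"
proof (induction rule: pres_eq.induct)
  case (cancel x b)
  show ?case by (cases b) (simp_all add: exponent_sum_def)
next
  case (relation u v)
  then show ?case by (auto simp: braid_relations_def exponent_sum_def)
qed (simp_all add: exponent_sum_append)

text \<open>The abelianisation map to the integers, read off an arbitrary word of the class.\<close>

definition braid_exponent :: "nat gword set \<Rightarrow> int" where
  "braid_exponent g = exponent_sum (SOME u. u \<in> g)"

lemma braid_exponent_class:
  assumes "u \<in> braid_words n"
  shows "braid_exponent (braid_class n u) = exponent_sum u"
proof -
  have "u \<in> braid_class n u"
    using assms by (simp add: braid_class_def braid_words_def pres_class_def pres_eq.refl)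
  then have "(SOME v. v \<in> braid_class n u) \<in> braid_class n u" by (rule someI)
  then have "pres_eq {1..n - 1} (braid_relations n) u (SOME v. v \<in> braid_class n u)"
    by (simp add: braid_class_def pres_class_def)
  then show ?thesis unfolding braid_exponent_def by (rule exponent_sum_pres_eq[symmetric])
qed

lemma braid_exponent_mult:
  assumes "g \<in> carrier (braid_group n)" "h \<in> carrier (braid_group n)"
  shows "braid_exponent (g \<otimes>\<^bsub>braid_group n\<^esub> h) = braid_exponent g + braid_exponent h"
  using assms unfolding carrier_braid_group
  by (auto simp: mult_braid_class braid_exponent_class braid_words_append exponent_sum_append)

lemma braid_exponent_gen: "1 \<le> i \<Longrightarrow> i < n \<Longrightarrow> braid_exponent (braid_gen n i) = 1"
  unfolding braid_gen_class
  by (subst braid_exponent_class) (simp_all add: braid_words_simps exponent_sum_def)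

lemma smult_smult_mat: "a \<cdot>\<^sub>m (b \<cdot>\<^sub>m A) = (a * b) \<cdot>\<^sub>m (A :: complex mat)"
  by (intro eq_matI) (auto simp: mult.assoc)

text \<open>Twist by a character. The sign \<open>s\<close> lets one lemma yield both the
  one-dimensional factor, from the trivial representation with \<open>s = 1\<close>, and the
  compensating twist with \<open>s = - 1\<close>.\<close>

lemma powi_exponent_rep:
  assumes c: "c \<noteq> 0" and \<rho>: "matrix_rep (braid_group n) r \<rho>"
  shows "matrix_rep (braid_group n) r (\<lambda>g. (c powi (s * braid_exponent g)) \<cdot>\<^sub>m \<rho> g)"
  unfolding matrix_rep_def
proof (rule homI)
  note \<rho>h = \<rho>[unfolded matrix_rep_def]
  fix g h assume g: "g \<in> carrier (braid_group n)" and h: "h \<in> carrier (braid_group n)"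
  have G: "\<rho> g \<in> carrier (GL r)" and H: "\<rho> h \<in> carrier (GL r)"
    using hom_in_carrier[OF \<rho>h] g h by auto
  obtain B where B: "B \<in> carrier_mat r r" "B * \<rho> g = 1\<^sub>m r" "\<rho> g * B = 1\<^sub>m r"
    using GL_inverse[OF G] by auto
  have inv: "c powi (s * braid_exponent g) * c powi (- (s * braid_exponent g)) = 1"
    using c by (simp add: power_int_minus)
  show "(c powi (s * braid_exponent g)) \<cdot>\<^sub>m \<rho> g \<in> carrier (GL r)"
    by (rule GL_I[where B = "(c powi (- (s * braid_exponent g))) \<cdot>\<^sub>m B"])
      (use GL_carrier[OF G] B inv in \<open>auto simp: mult_smult_assoc_mat[of _ r r _ r]
        mult_smult_distrib[of _ r r _ r] smult_smult_mat mult.commute\<close>)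
  have "\<rho> (g \<otimes>\<^bsub>braid_group n\<^esub> h) = \<rho> g * \<rho> h"
    using hom_mult[OF \<rho>h g h] by (simp add: GL_mult)
  then show "(c powi (s * braid_exponent (g \<otimes>\<^bsub>braid_group n\<^esub> h))) \<cdot>\<^sub>m \<rho> (g \<otimes>\<^bsub>braid_group n\<^esub> h)
    = ((c powi (s * braid_exponent g)) \<cdot>\<^sub>m \<rho> g) \<otimes>\<^bsub>GL r\<^esub> ((c powi (s * braid_exponent h)) \<cdot>\<^sub>m \<rho> h)"
    using GL_carrier[OF G] GL_carrier[OF H] c
    by (simp add: GL_mult braid_exponent_mult[OF g h] distrib_left power_int_add
        mult_smult_assoc_mat[of _ r r _ r] mult_smult_distrib[of _ r r _ r] smult_smult_mat mult.commute)
qed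

lemma trivial_rep: "matrix_rep (braid_group n) r (\<lambda>g. 1\<^sub>m r)"
  unfolding matrix_rep_def by (rule homI) (auto simp: GL_mult intro: GL_I[where B = "1\<^sub>m r"])

text \<open>Used to see that twisting preserves irreducibility.\<close>

lemma smult_mat_invariant_iff:
  assumes W: "VectorSpace.subspace class_ring W (module_vec TYPE(complex) r)"
    and A: "A \<in> carrier_mat r r" and c: "c \<noteq> 0"
  shows "(\<forall>w\<in>W. (c \<cdot>\<^sub>m A) *\<^sub>v w \<in> W) \<longleftrightarrow> (\<forall>w\<in>W. A *\<^sub>v w \<in> W)"
proof -
  have sm: "submodule class_ring W (module_vec TYPE(complex) r)"
    using W by (simp add: VectorSpace.subspace_def)
  have WC: "W \<subseteq> carrier_vec r"
    using submodule.subset[OF sm] by (simp add: module_vec_simps)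
  have sc: "d \<cdot>\<^sub>v w \<in> W" if "w \<in> W" for d w
    using submodule.smult_closed[OF sm, of d w] that by (simp add: module_vec_simps class_ring_simps)
  have eq: "(c \<cdot>\<^sub>m A) *\<^sub>v w = c \<cdot>\<^sub>v (A *\<^sub>v w)" if "w \<in> W" for w
    using A WC that by (intro eq_vecI) (auto simp: scalar_prod_def sum_distrib_left mult.assoc)
  have "A *\<^sub>v w \<in> W" if "c \<cdot>\<^sub>v (A *\<^sub>v w) \<in> W" for w
    using sc[OF that, of "inverse c"] c by (simp add: smult_smult_assoc)
  then show ?thesis using eq sc by auto
qed

lemma kronecker_product_scalar: "kronecker_product (d \<cdot>\<^sub>m 1\<^sub>m 1) A = d \<cdot>\<^sub>m A"
  unfolding kronecker_product_def by (intro eq_matI) auto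

text \<open>The generators are renumbered from 0. Outside the range the identity matrix is taken,
  since \<open>braid_module\<close> asks for linearity at every index.\<close>

definition gen_act :: "nat \<Rightarrow> nat \<Rightarrow> (nat gword set \<Rightarrow> complex mat) \<Rightarrow> nat \<Rightarrow> (nat \<Rightarrow> complex) \<Rightarrow> nat \<Rightarrow> complex" where
  "gen_act n r \<rho> i = act r (if i < n - 1 then \<rho> (braid_gen n (Suc i)) else 1\<^sub>m r)"

section \<open>Matrix representations as braid modules\<close>

context
  fixes n r :: nat and \<rho> :: "nat gword set \<Rightarrow> complex mat"
  assumes rep: "matrix_rep (braid_group n) r \<rho>"
begin

lemmas rep_hom = rep[unfolded matrix_rep_def]

lemma rep_carrier: "g \<in> carrier (braid_group n) \<Longrightarrow> \<rho> g \<in> carrier_mat r r"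
  using hom_in_carrier[OF rep_hom] by (intro GL_carrier)

lemma rep_mult:
  "g \<in> carrier (braid_group n) \<Longrightarrow> h \<in> carrier (braid_group n) \<Longrightarrow>
    \<rho> (g \<otimes>\<^bsub>braid_group n\<^esub> h) = \<rho> g * \<rho> h"
  using hom_mult[OF rep_hom] by (simp add: GL_mult)

lemma rep_one: "\<rho> (braid_class n []) = 1\<^sub>m r"
  using hom_one[OF rep_hom group_braid_group group_GL] by (simp add: one_braid_group GL_one)

lemma braid_mult_closed:
  "g \<in> carrier (braid_group n) \<Longrightarrow> h \<in> carrier (braid_group n) \<Longrightarrow>
    g \<otimes>\<^bsub>braid_group n\<^esub> h \<in> carrier (braid_group n)"
  using group.is_monoid[OF group_braid_group] by (rule monoid.m_closed)

lemma act_rep_mult: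
  "g \<in> carrier (braid_group n) \<Longrightarrow> h \<in> carrier (braid_group n) \<Longrightarrow>
    act r (\<rho> (g \<otimes>\<^bsub>braid_group n\<^esub> h)) f = act r (\<rho> g) (act r (\<rho> h) f)"
  by (simp add: rep_mult rep_carrier act_mult)

lemma gen_act_eq: "i < n - 1 \<Longrightarrow> gen_act n r \<rho> i = act r (\<rho> (braid_gen n (Suc i)))"
  by (simp add: gen_act_def)

lemma braid_module_rep: "braid_module fscale (n - 1) (gen_act n r \<rho>) (coord_space r)"
proof (intro braid_module.intro braid_module_axioms.intro fun_space.complex_vector_space_axioms)
  show "fun_space.endomorphism (gen_act n r \<rho> i)" for i
    unfolding gen_act_def by (rule endomorphism_act) (simp add: rep_carrier braid_gen_carrier)
  show "fun_space.findim (coord_space r)" by (rule findim_coord_space)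
  show "gen_act n r \<rho> i f \<in> coord_space r" for i f by (simp add: gen_act_def act_in)
  show "f = 0" if i: "i < n - 1" and f: "f \<in> coord_space r" "gen_act n r \<rho> i f = 0" for i f
  proof -
    let ?g = "braid_gen n (Suc i)"
    have g: "?g \<in> carrier (braid_group n)" using i by (intro braid_gen_carrier) auto
    obtain B where B: "B \<in> carrier_mat r r" "B * \<rho> ?g = 1\<^sub>m r"
      using GL_inverse[OF hom_in_carrier[OF rep_hom g]] by auto
    have "f = act r (B * \<rho> ?g) f" using f(1) B(2) by (simp add: act_one)
    also have "\<dots> = act r B (gen_act n r \<rho> i f)"
      using B(1) rep_carrier[OF g] i by (simp add: act_mult gen_act_eq)
    also have "\<dots> = 0"
      unfolding f(2) using fun_space.endo.linear_0[OF endomorphism_act[OF B(1)]] .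
    finally show ?thesis .
  qed
  show "gen_act n r \<rho> i (gen_act n r \<rho> j f) = gen_act n r \<rho> j (gen_act n r \<rho> i f)"
    if ij: "j < n - 1" "i + 2 \<le> j" for i j f
  proof -
    have c: "braid_gen n (Suc i) \<in> carrier (braid_group n)" "braid_gen n (Suc j) \<in> carrier (braid_group n)"
      using ij by (auto intro!: braid_gen_carrier)
    have "braid_gen n (Suc i) \<otimes>\<^bsub>braid_group n\<^esub> braid_gen n (Suc j)
        = braid_gen n (Suc j) \<otimes>\<^bsub>braid_group n\<^esub> braid_gen n (Suc i)"
      using ij by (intro braid_gen_far) auto
    then show ?thesis
      using act_rep_mult[OF c, of f] act_rep_mult[OF c(2,1), of f] ij by (simp add: gen_act_eq)
  qed
  show "gen_act n r \<rho> i (gen_act n r \<rho> (Suc i) (gen_act n r \<rho> i f))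
      = gen_act n r \<rho> (Suc i) (gen_act n r \<rho> i (gen_act n r \<rho> (Suc i) f))"
    if i: "Suc i < n - 1" for i f
  proof -
    let ?g = "braid_gen n (Suc i)" and ?h = "braid_gen n (Suc (Suc i))"
    have c: "?g \<in> carrier (braid_group n)" "?h \<in> carrier (braid_group n)"
      using i by (auto intro!: braid_gen_carrier)
    have "?g \<otimes>\<^bsub>braid_group n\<^esub> (?h \<otimes>\<^bsub>braid_group n\<^esub> ?g)
        = ?h \<otimes>\<^bsub>braid_group n\<^esub> (?g \<otimes>\<^bsub>braid_group n\<^esub> ?h)"
      using i by (intro braid_gen_braid) auto
    then show ?thesis
      using act_rep_mult[OF c(1) braid_mult_closed[OF c(2,1)], of f] act_rep_mult[OF c(2,1), of f]
        act_rep_mult[OF c(2) braid_mult_closed[OF c], of f] act_rep_mult[OF c, of f] i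
      by (simp add: gen_act_eq)
  qed
qed

text \<open>Invariance under the generators extends to their inverses, because injective operators
  map a finite-dimensional invariant subspace onto itself, and then to all words by
  induction.\<close>

lemma submodule_rep_trivial:
  assumes irr: "irreducible_rep (braid_group n) r \<rho>"
    and W: "fun_space.submodule (n - 1) (gen_act n r \<rho>) (coord_space r) W"
  shows "W = {0} \<or> W = coord_space r"
proof -
  interpret B: braid_module fscale "n - 1" "gen_act n r \<rho>" "coord_space r"
    by (rule braid_module_rep)
  note Ws = fun_space.submoduleD[OF W]
  define W' where "W' = {v \<in> carrier_vec r. ext r v \<in> W}"
  have W_eq: "W = ext r ` W'"
    using Ws(2) unfolding coord_space_eq W'_def by auto
  have "submodule class_ring W' (module_vec TYPE(complex) r)"
    unfolding submodule_def
    using vec_module fun_space.subspace_add[OF Ws(1)] fun_space.subspace_scale[OF Ws(1)]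
      fun_space.subspace_0[OF Ws(1)]
    by (auto simp: W'_def module_vec_simps ext_add ext_smult ext_zero)
  then have sub: "VectorSpace.subspace class_ring W' (module_vec TYPE(complex) r)"
    unfolding VectorSpace.subspace_def using vec_vs by blast
  have letter: "\<rho> (braid_class n [(b, i)]) *\<^sub>v w \<in> W'"
    if i: "1 \<le> i" "i < n" and w: "w \<in> W'" for b i w
  proof -
    have g: "braid_gen n i \<in> carrier (braid_group n)" using i by (rule braid_gen_carrier)
    have wC: "w \<in> carrier_vec r" "ext r w \<in> W" using w by (auto simp: W'_def)
    have gact: "gen_act n r \<rho> (i - 1) (ext r v) = ext r (\<rho> (braid_gen n i) *\<^sub>v v)"
      if "v \<in> carrier_vec r" for v
      using that i by (simp add: gen_act_eq act_ext)
    have C: "\<rho> (braid_gen n i) *\<^sub>v v \<in> carrier_vec r" if "v \<in> carrier_vec r" for v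
      using rep_carrier[OF g] that by simp
    show ?thesis
    proof (cases b)
      case True
      have "gen_act n r \<rho> (i - 1) (ext r w) \<in> W" using Ws(3)[of "i - 1"] i wC(2) by simp
      then show ?thesis using True gact[OF wC(1)] C[OF wC(1)] by (simp add: W'_def braid_gen_class)
    next
      case False
      \<comment> \<open>Inverse letter: \<open>w\<close> is the image of some \<open>v\<close> in
        \<open>W'\<close> under the generator, and the inverse letter returns
        \<open>v\<close>.\<close>
      have "ext r w \<in> gen_act n r \<rho> (i - 1) ` W"
        using B.generator_submodule[OF W, of "i - 1"] i wC(2) by simp
      then obtain v where v: "v \<in> W'" "ext r w = gen_act n r \<rho> (i - 1) (ext r v)"
        unfolding W_eq by auto
      have vC: "v \<in> carrier_vec r" using v(1) by (simp add: W'_def)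
      have weq: "w = \<rho> (braid_gen n i) *\<^sub>v v"
        using inj_onD[OF inj_on_ext _ wC(1) C[OF vC]] v(2) gact[OF vC] by simp
      let ?h = "braid_class n [(False, i)]"
      have h: "?h \<in> carrier (braid_group n)"
        unfolding carrier_braid_group using i by (intro imageI) (simp add: braid_words_simps)
      have "pres_eq {1..n - 1} (braid_relations n) [(False, i), (True, i)] []"
        using pres_eq.cancel[of i "{1..n - 1}" "braid_relations n" False] i by simp
      then have "braid_class n [(False, i), (True, i)] = braid_class n []"
        using pres_class_eq_iff pres_eq_gwords unfolding braid_class_def by metis
      then have "?h \<otimes>\<^bsub>braid_group n\<^esub> braid_gen n i = braid_class n []"
        using i by (simp add: braid_gen_class mult_braid_class braid_words_simps)
      then have "\<rho> ?h * \<rho> (braid_gen n i) = 1\<^sub>m r"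
        using rep_mult[OF h g] rep_one by simp
      moreover have "\<rho> ?h *\<^sub>v w = (\<rho> ?h * \<rho> (braid_gen n i)) *\<^sub>v v"
        unfolding weq using assoc_mult_mat_vec[OF rep_carrier[OF h] rep_carrier[OF g] vC] by simp
      ultimately show ?thesis using v(1) vC False by simp
    qed
  qed
  have "\<rho> (braid_class n u) *\<^sub>v w \<in> W'" if "u \<in> braid_words n" "w \<in> W'" for u w
    using that
  proof (induction u)
    case Nil
    then show ?case using rep_one by (simp add: W'_def)
  next
    case (Cons l u)
    obtain b i where l: "l = (b, i)" by (cases l)
    have u: "1 \<le> i" "i < n" "u \<in> braid_words n" using Cons.prems l by (auto simp: braid_words_simps)
    have lw: "[(b, i)] \<in> braid_words n" using u by (simp add: braid_words_simps)
    have c: "braid_class n [(b, i)] \<in> carrier (braid_group n)" "braid_class n u \<in> carrier (braid_group n)"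
      unfolding carrier_braid_group using lw u(3) by auto
    have "braid_class n (l # u) = braid_class n [(b, i)] \<otimes>\<^bsub>braid_group n\<^esub> braid_class n u"
      using mult_braid_class[OF lw u(3)] l by simp
    then have "\<rho> (braid_class n (l # u)) *\<^sub>v w = \<rho> (braid_class n [(b, i)]) *\<^sub>v (\<rho> (braid_class n u) *\<^sub>v w)"
      using rep_mult[OF c] assoc_mult_mat_vec[OF rep_carrier[OF c(1)] rep_carrier[OF c(2)]] Cons.prems(2)
      by (simp add: W'_def)
    then show ?case using letter[OF u(1,2) Cons.IH[OF u(3) Cons.prems(2)]] by simp
  qed
  then have "\<forall>g\<in>carrier (braid_group n). \<forall>w\<in>W'. \<rho> g *\<^sub>v w \<in> W'"
    unfolding carrier_braid_group by auto
  then have "W' = {0\<^sub>v r} \<or> W' = carrier_vec r"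
    using irr sub unfolding irreducible_rep_def by blast
  then show ?thesis unfolding W_eq coord_space_eq by (auto simp: ext_zero)
qed

text \<open>The exponent of a generator is 1, so the matrix in question is
  \<open>\<rho> (braid_gen n 1)\<close> divided by \<open>c\<close>, minus the identity. It acts as
  \<open>dev c 0\<close> after division by \<open>c\<close>, and that division maps the coordinate
  space onto itself.\<close>

lemma corank_scaled_rep:
  assumes n: "2 \<le> n" and c: "c \<noteq> 0"
  shows "corank n r (\<lambda>g. (c powi (- 1 * braid_exponent g)) \<cdot>\<^sub>m \<rho> g)
    = fun_space.dim (braid_module.dev fscale (gen_act n r \<rho>) c 0 ` coord_space r)"
proof -
  interpret B: braid_module fscale "n - 1" "gen_act n r \<rho>" "coord_space r"
    by (rule braid_module_rep)
  let ?A = "\<rho> (braid_gen n 1)" and ?V = "coord_space r"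
  let ?M = "inverse c \<cdot>\<^sub>m ?A - 1\<^sub>m r"
  have A: "?A \<in> carrier_mat r r" using n by (intro rep_carrier braid_gen_carrier) auto
  have M: "?M \<in> carrier_mat r r" by (intro minus_carrier_mat one_carrier_mat)
  have "act r ?M f = B.dev c 0 (fscale (inverse c) f)" if "f \<in> ?V" for f
  proof -
    have "act r ?M f = fscale (inverse c) (act r ?A f) - act r (1\<^sub>m r) f"
      unfolding act_eq_sum[OF M] act_eq_sum[OF A] act_eq_sum[OF one_carrier_mat]
      using A by (auto simp: fun_eq_iff fscale_def sum_distrib_left sum_subtractf left_diff_distrib
          mult.assoc intro!: sum.cong)
    also have "\<dots> = B.dev c 0 (fscale (inverse c) f)"
      unfolding B.dev_def B.lin_simps using that c n by (simp add: gen_act_eq act_one)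
    finally show ?thesis .
  qed
  then have "act r ?M ` ?V = (\<lambda>f. B.dev c 0 (fscale (inverse c) f)) ` ?V"
    by (rule image_cong[OF HOL.refl])
  also have "\<dots> = B.dev c 0 ` fscale (inverse c) ` ?V" by (simp add: image_image)
  also have "fscale (inverse c) ` ?V = ?V"
  proof
    show "fscale (inverse c) ` ?V \<subseteq> ?V"
      using fun_space.subspace_scale[OF subspace_coord_space] by auto
    show "?V \<subseteq> fscale (inverse c) ` ?V"
    proof
      fix f assume "f \<in> ?V"
      then show "f \<in> fscale (inverse c) ` ?V"
        using c fun_space.subspace_scale[OF subspace_coord_space, of f r c]
        by (intro image_eqI[of _ _ "fscale c f"]) simp_all
    qed
  qed
  finally have "act r ?M ` ?V = B.dev c 0 ` ?V" .
  then show ?thesis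
    using dim_act_image[OF M] n by (simp add: corank_def braid_exponent_gen power_int_minus)
qed

end

theorem theorem3p8:
  fixes n r :: nat and \<rho> :: "nat gword set \<Rightarrow> complex mat"
  assumes "n \<ge> 10" and "n + 1 \<le> r" and "r \<le> 2 * n - 9"
    and "irreducible_rep (braid_group n) r \<rho>"
  shows "\<exists>\<chi> \<rho>' k. matrix_rep (braid_group n) 1 \<chi> \<and>
           irreducible_rep (braid_group n) r \<rho>' \<and>
           corank n r \<rho>' = k \<and> 3 \<le> k \<and> k \<le> r - n + 2 \<and>
           equivalent_reps (braid_group n) r \<rho> (tensor_rep \<chi> \<rho>')"
proof -
  have rep: "matrix_rep (braid_group n) r \<rho>" using assms(4) by (simp add: irreducible_rep_def)
  interpret B: braid_module fscale "n - 1" "gen_act n r \<rho>" "coord_space r"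
    by (rule braid_module_rep[OF rep])
  \<comment> \<open>With \<open>q = n - 1\<close>, the range from \<open>n + 1\<close> to
    \<open>2 * n - 9\<close> becomes that from \<open>q + 2\<close> to
    \<open>2 * q - 7\<close>.\<close>
  have "9 \<le> n - 1" "n - 1 + 2 \<le> fun_space.dim (coord_space r)"
    "fun_space.dim (coord_space r) \<le> 2 * (n - 1) - 7"
    using assms(1-3) by (simp_all add: dim_coord_space)
  then obtain c where c: "c \<noteq> 0" "3 \<le> fun_space.dim (B.dev c 0 ` coord_space r)"
    "fun_space.dim (B.dev c 0 ` coord_space r) \<le> r + 1 - (n - 1)"
    using B.irreducible_dev_dim[OF submodule_rep_trivial[OF rep assms(4)]]
    unfolding dim_coord_space by blast
  \<comment> \<open>The character takes the value \<open>c\<close> on every generator, and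
    \<open>\<rho>'\<close> is \<open>\<rho>\<close> twisted by its inverse.\<close>
  define \<chi> where "\<chi> g = (c powi (1 * braid_exponent g)) \<cdot>\<^sub>m (1\<^sub>m 1 :: complex mat)" for g
  define \<rho>' where "\<rho>' g = (c powi (- 1 * braid_exponent g)) \<cdot>\<^sub>m \<rho> g" for g
  have \<chi>: "matrix_rep (braid_group n) 1 \<chi>"
    unfolding \<chi>_def[abs_def] by (rule powi_exponent_rep[OF c(1) trivial_rep])
  have \<rho>': "matrix_rep (braid_group n) r \<rho>'"
    unfolding \<rho>'_def[abs_def] by (rule powi_exponent_rep[OF c(1) rep])
  have "W = {0\<^sub>v r} \<or> W = carrier_vec r"
    if W: "VectorSpace.subspace class_ring W (module_vec TYPE(complex) r)"
      "\<forall>g\<in>carrier (braid_group n). \<forall>w\<in>W. \<rho>' g *\<^sub>v w \<in> W" for W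
  proof -
    have "\<forall>w\<in>W. \<rho> g *\<^sub>v w \<in> W" if g: "g \<in> carrier (braid_group n)" for g
    proof -
      have "c powi (- 1 * braid_exponent g) \<noteq> 0" using c(1) by simp
      from smult_mat_invariant_iff[OF W(1) rep_carrier[OF rep g] this] show ?thesis
        using W(2) g unfolding \<rho>'_def by blast
    qed
    then show ?thesis using assms(4) W(1) unfolding irreducible_rep_def by blast
  qed
  then have irr: "irreducible_rep (braid_group n) r \<rho>'"
    using \<rho>' assms(2) unfolding irreducible_rep_def by simp
  have corank: "corank n r \<rho>' = fun_space.dim (B.dev c 0 ` coord_space r)"
    unfolding \<rho>'_def[abs_def] using corank_scaled_rep[OF rep _ c(1)] assms(1) by simp
  \<comment> \<open>The opposite twists cancel, so the tensor product is \<open>\<rho>\<close>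
    itself and the identity serves as conjugating matrix.\<close>
  have "\<rho> g = \<one>\<^bsub>GL r\<^esub> \<otimes>\<^bsub>GL r\<^esub> tensor_rep \<chi> \<rho>' g \<otimes>\<^bsub>GL r\<^esub> inv\<^bsub>GL r\<^esub> \<one>\<^bsub>GL r\<^esub>"
    if g: "g \<in> carrier (braid_group n)" for g
  proof -
    have inv: "inv\<^bsub>GL r\<^esub> \<one>\<^bsub>GL r\<^esub> = \<one>\<^bsub>GL r\<^esub>"
      using group.is_monoid[OF group_GL] by (rule monoid.inv_one)
    have "tensor_rep \<chi> \<rho>' g = (c powi braid_exponent g * c powi (- braid_exponent g)) \<cdot>\<^sub>m \<rho> g"
      unfolding tensor_rep_def \<chi>_def \<rho>'_def kronecker_product_scalar smult_smult_mat by simp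
    also have "c powi braid_exponent g * c powi (- braid_exponent g) = 1"
      using c(1) by (simp add: power_int_minus)
    also have "1 \<cdot>\<^sub>m \<rho> g = \<rho> g" by (intro eq_matI) auto
    finally show ?thesis unfolding inv using rep_carrier[OF rep g] by (simp add: GL_mult GL_one)
  qed
  moreover have "\<one>\<^bsub>GL r\<^esub> \<in> carrier (GL r)"
    using group.is_monoid[OF group_GL] by (rule monoid.one_closed)
  ultimately have "equivalent_reps (braid_group n) r \<rho> (tensor_rep \<chi> \<rho>')"
    unfolding equivalent_reps_def by blast
  moreover have "r + 1 - (n - 1) = r - n + 2" using assms(1,2) by simp
  ultimately show ?thesis using \<chi> irr corank c(2,3) by metis
qed

end
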